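(* For $(\tilde t,q)\in\tilde D$, $$-(\tilde t-q)\log4+\log\zeta(2\tilde t-2q)\le P_1(\tilde t,q)\le\log\zeta(2\tilde t-2q).$$ Moreover: (1) for any point $(\tilde t_0,q_0)$ on the line $\tilde t-q=1/2$, $\lim_{(\tilde t,q)\to(\tilde t_0,q_0),\,(\tilde t,q)\in\tilde D}P_1(\tilde t,q)=\infty$; (2) for fixed $\tilde t\in\mathbb{R}$, $\lim_{q\to(\tilde t-\frac12)^-}\frac{\partial P_1}{\partial q}(\tilde t,q)=+\infty$; (3) with $\gamma_0=2\log\frac{1+\sqrt5}2$, for fixed $\tilde t\in\mathbb{R}$, $\lim_{q\to-\infty}\frac{P_1(\tilde t,q)}q=\gamma_0$ and $\lim_{q\to-\infty}\frac{\partial P_1}{\partial q}(\tilde t,q)=\gamma_0$.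
   Context: $\tilde D=\{(\tilde t,q)\in\mathbb{R}^2:\tilde t-q>1/2\}$; $\zeta(s)=\sum_{n\ge1}n^{-s}$ for $s>1$. Write $[\omega_1,\dots,\omega_n+x]=\cfrac{1}{\omega_1+\cfrac{1}{\ddots+\cfrac{1}{\omega_n+x}}}$. For $(\tilde t,q)\in\tilde D$, $$P_1(\tilde t,q)=\lim_{n\to\infty}\frac1n\log\sum_{\omega_1=1}^\infty\cdots\sum_{\omega_n=1}^\infty\exp\Big(\sup_{x\in[0,1]}\log\prod_{j=1}^n([\omega_j,\dots,\omega_n+x])^{2(\tilde t-q)}\Big),$$ a real-analytic function on $\tilde D$. *)

theory Defs
  imports "HOL-Analysis.Analysis"
begin

definition Dtilde :: "(real \<times> real) set" where
  "Dtilde = {(t, q). t - q > 1/2}"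

definition zeta :: "real \<Rightarrow> real" where
  "zeta s = (\<Sum>n. real (Suc n) powr (- s))"

text \<open>For nonempty \<open>ws\<close> this is \<open>[\<omega>\<^sub>1, \<dots>, \<omega>\<^sub>n + x]\<close>; in the innermost step
  \<open>cfrac_tail [] x = x\<close> is added to \<open>\<omega>\<^sub>n\<close>.\<close>

primrec cfrac_tail :: "nat list \<Rightarrow> real \<Rightarrow> real" where
  "cfrac_tail [] x = x"
| "cfrac_tail (w # ws) x = 1 / (real w + cfrac_tail ws x)"

definition words :: "nat \<Rightarrow> nat list set" where
  "words n = {ws. length ws = n \<and> (\<forall>w\<in>set ws. w \<ge> 1)}"

text \<open>The list \<open>drop j ws\<close> is \<open>\<omega>\<^bsub>j+1\<^esub>, \<dots>, \<omega>\<^sub>n\<close>, so the product runs over all tails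
  of the word.  The \<open>n\<close>-fold series of nonnegative terms is an unordered sum over words.\<close>

definition partition_sum :: "nat \<Rightarrow> real \<Rightarrow> real \<Rightarrow> real" where
  "partition_sum n t q =
     (\<Sum>\<^sub>\<infinity>ws\<in>words n.
        exp (SUP x\<in>{0..1}. ln (\<Prod>j<n. cfrac_tail (drop j ws) x powr (2 * (t - q)))))"

definition P1 :: "real \<Rightarrow> real \<Rightarrow> real" where
  "P1 t q = lim (\<lambda>n. 1 / real n * ln (partition_sum n t q))"

definition gamma0 :: real where
  "gamma0 = 2 * ln ((1 + sqrt 5) / 2)"

end

theory Submission
  imports Defs "HOL-Real_Asymp.Real_Asymp"
begin

text \<open>
  \<open>P1 t q\<close> depends only on \<open>s = 2 (t - q)\<close>, through the pressure \<open>p s\<close> of the operator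
  \<open>L F x = \<Sum>k. (k + x) powr (-s) * F (1 / (k + x))\<close>: the partition sum is \<open>(L ^^ n) 1\<close> at 0. All
  estimates are made for the alphabet \<open>{1..M}\<close>, uniformly in \<open>M\<close>.

  The heart of the matter is that \<open>p\<close> is differentiable. The cone of nonnegative decreasing
  functions \<open>F\<close> on \<open>[0,1]\<close> with \<open>(1 + x) powr s * F x\<close> increasing is mapped by \<open>L\<close> into a part of
  itself of finite projective diameter, so \<open>L\<close> contracts the order intervals of the cone. Hence
  the oscillation in \<open>x\<close> of the logarithmic derivative in \<open>s\<close> of \<open>(L ^^ n) 1 x\<close> is bounded
  independently of \<open>n\<close>. Each application of \<open>L\<close> therefore adds only a bounded variance to the
  second logarithmic derivative, which is \<open>O(n)\<close>. So \<open>p\<close> is convex and locally semiconcave.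

  Given differentiability, convexity turns the limits of \<open>p\<close> at \<open>s = 1\<close> and of \<open>p s / s\<close> at infinity
  into those of the derivative. The latter limit comes from the word \<open>1, 1, 1, \<dots>\<close>, whose
  continued fraction products are the largest.
\<close>

section \<open>An invariant cone\<close>


definition trunc_op :: "nat \<Rightarrow> real \<Rightarrow> (real \<Rightarrow> real) \<Rightarrow> real \<Rightarrow> real" where
  "trunc_op M s F x = (\<Sum>k=1..M. (real k + x) powr (-s) * F (1 / (real k + x)))"

text \<open>The inversion \<open>x \<mapsto> 1 / (k + x)\<close> exchanges the two monotonicity
  conditions, so they are imposed together. Jointly they keep \<open>F\<close> on the unit interval
  within the factor \<open>2 powr s\<close> of \<open>F 0\<close>.\<close>

definition decay_cone :: "real \<Rightarrow> (real \<Rightarrow> real) set" where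
  "decay_cone s = {F. (\<forall>x\<in>{0..1}. 0 \<le> F x) \<and>
     (\<forall>x y. 0 \<le> x \<and> x \<le> y \<and> y \<le> 1 \<longrightarrow>
        F y \<le> F x \<and> (1 + x) powr s * F x \<le> (1 + y) powr s * F y)}"

lemma coneI:
  assumes "\<And>x. 0 \<le> x \<Longrightarrow> x \<le> 1 \<Longrightarrow> 0 \<le> F x"
    and "\<And>x y. 0 \<le> x \<Longrightarrow> x \<le> y \<Longrightarrow> y \<le> 1 \<Longrightarrow> F y \<le> F x"
    and "\<And>x y. 0 \<le> x \<Longrightarrow> x \<le> y \<Longrightarrow> y \<le> 1 \<Longrightarrow> (1 + x) powr s * F x \<le> (1 + y) powr s * F y"
  shows "F \<in> decay_cone s"
  using assms by (auto simp: decay_cone_def)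

lemma cone_nonneg: "F \<in> decay_cone s \<Longrightarrow> 0 \<le> x \<Longrightarrow> x \<le> 1 \<Longrightarrow> 0 \<le> F x"
  by (auto simp: decay_cone_def)

lemma cone_antimono: "F \<in> decay_cone s \<Longrightarrow> 0 \<le> x \<Longrightarrow> x \<le> y \<Longrightarrow> y \<le> 1 \<Longrightarrow> F y \<le> F x"
  by (auto simp: decay_cone_def)

lemma cone_mono:
  "F \<in> decay_cone s \<Longrightarrow> 0 \<le> x \<Longrightarrow> x \<le> y \<Longrightarrow> y \<le> 1 \<Longrightarrow> (1 + x) powr s * F x \<le> (1 + y) powr s * F y"
  by (auto simp: decay_cone_def)

lemma cone_lower:
  assumes "F \<in> decay_cone s" "0 \<le> x" "x \<le> 1" "0 \<le> s"
  shows "2 powr (-s) * F 0 \<le> F x"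
proof -
  have "F 0 \<le> (1 + x) powr s * F x"
    using cone_mono[OF assms(1), of 0 x] assms by simp
  also have "\<dots> \<le> 2 powr s * F x"
    using assms cone_nonneg[OF assms(1)] by (intro mult_right_mono powr_mono2) auto
  finally show ?thesis by (simp add: powr_minus field_simps)
qed

lemma cone_add: "F \<in> decay_cone s \<Longrightarrow> G \<in> decay_cone s \<Longrightarrow> (\<lambda>x. F x + G x) \<in> decay_cone s"
  unfolding decay_cone_def by (fastforce simp: distrib_left intro: add_mono)

lemma cone_cmult:
  assumes "F \<in> decay_cone s" "0 \<le> c" shows "(\<lambda>x. c * F x) \<in> decay_cone s"
proof (rule coneI)
  fix x y :: real assume "0 \<le> x" "x \<le> y" "y \<le> 1"
  then show "(1 + x) powr s * (c * F x) \<le> (1 + y) powr s * (c * F y)"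
    using mult_left_mono[OF cone_mono[OF assms(1)] assms(2), of x y] by (simp add: mult_ac)
qed (use assms in \<open>auto simp: decay_cone_def mult_left_mono\<close>)

lemma cone_sum:
  assumes "finite I" "\<And>i. i \<in> I \<Longrightarrow> F i \<in> decay_cone s"
  shows "(\<lambda>x. \<Sum>i\<in>I. F i x) \<in> decay_cone s"
  using assms
proof (induction I rule: finite_induct)
  case empty then show ?case by (auto simp: decay_cone_def)
next
  case (insert i I) then show ?case by (simp add: cone_add)
qed

lemma one_in_cone: "0 \<le> s \<Longrightarrow> (\<lambda>_. 1) \<in> decay_cone s"
  by (rule coneI) (auto intro!: powr_mono2)

text \<open>Writing \<open>z powr (-s) * F (1 / z)\<close> as \<open>(z + 1) powr (-s)\<close> times
  the weighted \<open>F\<close> at \<open>1 / z\<close> turns the weighted condition into decrease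
  of the branch. Conversely, decrease of \<open>F\<close> yields the weighted condition, because
  \<open>(1 + x) / (k + x)\<close> does not decrease. The weight \<open>c\<close> makes room for the
  logarithms produced by differentiation in \<open>s\<close>.\<close>

lemma cone_branch:
  fixes c :: "real \<Rightarrow> real"
  assumes F: "F \<in> decay_cone s" and s: "0 \<le> s" and k: "1 \<le> k"
    and c0: "\<And>z. 1 \<le> z \<Longrightarrow> 0 \<le> c z"
    and c_mono: "\<And>z z'. 1 \<le> z \<Longrightarrow> z \<le> z' \<Longrightarrow> c z \<le> c z'"
    and c_anti: "\<And>z z'. 1 \<le> z \<Longrightarrow> z \<le> z' \<Longrightarrow> c z' * (z' + 1) powr (-s) \<le> c z * (z + 1) powr (-s)"
  shows "(\<lambda>x. c (k + x) * ((k + x) powr (-s) * F (1 / (k + x)))) \<in> decay_cone s"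
proof (rule coneI)
  fix x :: real assume "0 \<le> x" "x \<le> 1"
  then show "0 \<le> c (k + x) * ((k + x) powr (-s) * F (1 / (k + x)))"
    using k by (intro mult_nonneg_nonneg c0 cone_nonneg[OF F]) auto
next
  fix x y :: real assume xy: "0 \<le> x" "x \<le> y" "y \<le> 1"
  define z z' where "z = k + x" and "z' = k + y"
  have z: "1 \<le> z" "z \<le> z'" using xy k by (auto simp: z_def z'_def)
  have inv: "1 / z' \<le> 1 / z" "0 \<le> 1 / z'" "1 / z \<le> 1" using z by (auto intro!: frac_le)
  have eq: "v powr (-s) * u = (v + 1) powr (-s) * ((1 + 1 / v) powr s * u)" if "1 \<le> v" for u v
  proof -
    have "v * (1 + 1 / v) = v + 1" using that by (simp add: field_simps)
    then have "(v + 1) powr s = v powr s * (1 + 1 / v) powr s"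
      using that powr_mult[of v "1 + 1 / v" s] by simp
    then show ?thesis using that by (simp add: powr_minus field_simps)
  qed
  have "c z' * (z' powr (-s) * F (1 / z')) = (c z' * (z' + 1) powr (-s)) * ((1 + 1 / z') powr s * F (1 / z'))"
    using eq[of z' "F (1/z')"] z by (simp only: mult.assoc)
  also have "\<dots> \<le> (c z * (z + 1) powr (-s)) * ((1 + 1 / z) powr s * F (1 / z))"
    using inv z by (intro mult_mono c_anti cone_mono[OF F] mult_nonneg_nonneg c0 cone_nonneg[OF F]) auto
  also have "\<dots> = c z * (z powr (-s) * F (1 / z))"
    using eq[of z "F (1/z)"] z by (simp only: mult.assoc)
  finally show "c (k + y) * ((k + y) powr (-s) * F (1 / (k + y))) \<le> c (k + x) * ((k + x) powr (-s) * F (1 / (k + x)))"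
    by (simp add: z_def z'_def)
  have "((1 + x) / z) powr s \<le> ((1 + y) / z') powr s"
  proof (rule powr_mono2)
    have "(1 + x) * z' \<le> (1 + y) * z"
      using mult_nonneg_nonneg[of "k - 1" "y - x"] k xy by (simp add: z_def z'_def algebra_simps)
    then show "(1 + x) / z \<le> (1 + y) / z'" using z by (simp add: divide_simps)
  qed (use s xy z in auto)
  then have p: "(1 + x) powr s * z powr (-s) \<le> (1 + y) powr s * z' powr (-s)"
    using xy z by (simp add: powr_divide powr_minus field_simps)
  have "((1 + x) powr s * z powr (-s)) * (c z * F (1 / z)) \<le> ((1 + y) powr s * z' powr (-s)) * (c z' * F (1 / z'))"
    using inv z by (intro mult_mono p c_mono cone_antimono[OF F] mult_nonneg_nonneg c0 cone_nonneg[OF F]) auto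
  then show "(1 + x) powr s * (c (k + x) * ((k + x) powr (-s) * F (1 / (k + x))))
      \<le> (1 + y) powr s * (c (k + y) * ((k + y) powr (-s) * F (1 / (k + y))))"
    by (simp add: z_def z'_def mult_ac)
qed

lemma cone_branch_plain:
  assumes "F \<in> decay_cone s" "0 \<le> s" "1 \<le> k"
  shows "(\<lambda>x. (k + x) powr (-s) * F (1 / (k + x))) \<in> decay_cone s"
proof -
  have "1 * (z' + 1) powr (-s) \<le> 1 * (z + 1) powr (-s)" if "1 \<le> z" "z \<le> z'" for z z' :: real
    using that assms(2) by (auto intro!: powr_mono2')
  from cone_branch[OF assms, of "\<lambda>_. 1", OF _ _ this] show ?thesis by simp
qed

lemma trunc_op_cone:
  assumes "F \<in> decay_cone s" "0 \<le> s" shows "trunc_op M s F \<in> decay_cone s"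
proof -
  have "(\<lambda>x. \<Sum>k=1..M. (real k + x) powr (-s) * F (1 / (real k + x))) \<in> decay_cone s"
    by (intro cone_sum cone_branch_plain assms) auto
  then show ?thesis by (simp add: trunc_op_def[abs_def])
qed

text \<open>Differentiating \<open>z powr (-s)\<close> creates the weight \<open>ln z\<close>. The
  shift by 2 makes \<open>(ln w + 2) * (w + 1) powr (-s)\<close> decreasing, since
  \<open>(w + 1) / w \<le> 2 \<le> s * (ln w + 2)\<close>; it is subtracted again in
  \<open>pfun1_bracket\<close>.\<close>

lemma log_branch_in_cone:
  assumes F: "F \<in> decay_cone s" and s: "1 \<le> s"
  shows "(\<lambda>x. \<Sum>k=1..M. (ln (real k + x) + 2) * ((real k + x) powr (-s) * F (1 / (real k + x)))) \<in> decay_cone s"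
proof -
  have anti: "(ln z' + 2) * (z' + 1) powr (-s) \<le> (ln z + 2) * (z + 1) powr (-s)"
    if z: "1 \<le> z" "z \<le> z'" for z z' :: real
  proof (rule DERIV_nonpos_imp_nonincreasing[OF z(2)])
    fix w assume w: "z \<le> w" "w \<le> z'"
    have "1 / w * (w + 1) \<le> s * (ln w + 2)"
    proof -
      have "1 / w * (w + 1) \<le> 2" using w z by (simp add: field_simps)
      also have "\<dots> \<le> 1 * (ln w + 2)" using w z by simp
      also have "\<dots> \<le> s * (ln w + 2)" using w z s by (intro mult_right_mono) auto
      finally show ?thesis .
    qed
    then have "((1 / w) * (w + 1) - s * (ln w + 2)) * (w + 1) powr (-s - 1) \<le> 0"
      by (intro mult_nonpos_nonneg) auto
    also have "((1 / w) * (w + 1) - s * (ln w + 2)) * (w + 1) powr (-s - 1) =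
        1 / w * ((w + 1) * (w + 1) powr (-s - 1)) + (-s * (w + 1) powr (-s - 1)) * (ln w + 2)"
      by algebra
    also have "(w + 1) * (w + 1) powr (-s - 1) = (w + 1) powr (-s)"
      using w z by (simp add: powr_diff)
    finally have "1 / w * (w + 1) powr (-s) + (-s * (w + 1) powr (-s - 1)) * (ln w + 2) \<le> 0" .
    moreover have "((\<lambda>w. (ln w + 2) * (w + 1) powr (-s)) has_real_derivative
        1 / w * (w + 1) powr (-s) + (-s * (w + 1) powr (-s - 1)) * (ln w + 2)) (at w)"
      using w z by (auto intro!: derivative_eq_intros)
    ultimately show "\<exists>y. ((\<lambda>w. (ln w + 2) * (w + 1) powr (-s)) has_real_derivative y) (at w) \<and> y \<le> 0"
      by blast
  qed
  have "(\<lambda>x. (ln (real k + x) + 2) * ((real k + x) powr (-s) * F (1 / (real k + x)))) \<in> decay_cone s"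
    if "k \<in> {1..M}" for k
    by (rule cone_branch[OF F _ _ _ _ anti]) (use that s in auto)
  then show ?thesis by (intro cone_sum) auto
qed

text \<open>Bernoulli's inequality for real exponents, from convexity of \<open>exp\<close>:
  \<open>ln u\<close> divides the segment from 0 to \<open>s * ln u\<close> in the ratio given by
  \<open>1 / s\<close>.\<close>

lemma one_minus_powr_le:
  fixes s u :: real
  assumes "1 \<le> s" "0 \<le> u" "u \<le> 1"
  shows "1 - u powr s \<le> s * (1 - u)"
proof (cases "u = 0")
  case False
  have "exp (1 / s * (s * ln u)) \<le> (1 - 1 / s) * 1 + 1 / s * exp (s * ln u)"
    using convex_onD[OF exp_convex, of "1 / s" 0 "s * ln u"] assms by simp
  then have "u \<le> (1 - 1 / s) + 1 / s * u powr s"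
    using assms False by (simp add: powr_def)
  then have "s * u \<le> s * ((1 - 1 / s) + 1 / s * u powr s)"
    using assms by (intro mult_left_mono) auto
  then show ?thesis using assms by (simp add: algebra_simps)
qed (use assms in auto)

section \<open>Finite diameter of the image cone\<close>


lemma powr_ratio_diff_le:
  fixes x y s :: real
  assumes "0 \<le> x" "x \<le> y" "1 \<le> s"
  shows "1 - ((1 + x) / (1 + y)) powr s \<le> s * (y - x)"
proof -
  have "1 - ((1 + x) / (1 + y)) powr s \<le> s * (1 - (1 + x) / (1 + y))"
    using assms by (intro one_minus_powr_le) (auto simp: divide_simps)
  also have "1 - (1 + x) / (1 + y) = (y - x) / (1 + y)" using assms by (simp add: field_simps)
  also have "s * ((y - x) / (1 + y)) \<le> s * ((y - x) / 1)"
    using assms by (intro mult_left_mono divide_left_mono) auto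
  finally show ?thesis by simp
qed

text \<open>The weighted condition limits the descent of \<open>B\<close> to the factor
  \<open>((1 + x) / (1 + y)) powr s\<close>. Such upper bounds on slopes are later compared with
  lower bounds on slopes of images.\<close>

lemma cone_diff_le:
  assumes B: "B \<in> decay_cone s" and xy: "0 \<le> x" "x \<le> y" "y \<le> 1" and s: "1 \<le> s"
  shows "B x - B y \<le> B 0 * s * (y - x)"
proof -
  have "((1 + x) / (1 + y)) powr s * B x \<le> B y"
    using cone_mono[OF B xy] xy by (simp add: powr_divide field_simps)
  then have "B x - B y \<le> B x * (1 - ((1 + x) / (1 + y)) powr s)" by (simp add: algebra_simps)
  also have "\<dots> \<le> B x * (s * (y - x))"
    using xy s by (intro mult_left_mono powr_ratio_diff_le cone_nonneg[OF B]) auto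
  also have "\<dots> \<le> B 0 * (s * (y - x))"
    using xy s by (intro mult_right_mono cone_antimono[OF B]) auto
  finally show ?thesis by (simp add: mult.assoc)
qed

text \<open>Since \<open>B\<close> decreases, only the weight \<open>(1 + x) powr s\<close> can
  contribute to growth.\<close>

lemma cone_weighted_diff_le:
  assumes B: "B \<in> decay_cone s" and xy: "0 \<le> x" "x \<le> y" "y \<le> 1" and s: "1 \<le> s"
  shows "(1 + y) powr s * B y - (1 + x) powr s * B x \<le> B 0 * 2 powr s * s * (y - x)"
proof -
  have "(1 + y) powr s * B y - (1 + x) powr s * B x \<le> (1 + y) powr s * B x - (1 + x) powr s * B x"
    using cone_antimono[OF B xy] by (simp add: mult_left_mono)
  also have "\<dots> = ((1 + y) powr s * B x) * (1 - ((1 + x) / (1 + y)) powr s)"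
    using xy by (simp add: powr_divide field_simps)
  also have "\<dots> \<le> (2 powr s * B 0) * (s * (y - x))"
    using xy s by (intro mult_mono powr_ratio_diff_le powr_mono2 mult_nonneg_nonneg
      cone_nonneg[OF B] cone_antimono[OF B]) (auto intro!: powr_le1)
  finally show ?thesis by (simp add: mult_ac)
qed

lemma trunc_op_le:
  assumes F: "F \<in> decay_cone s" and "(\<Sum>k=1..M. real k powr (-s)) \<le> Zb"
  shows "trunc_op M s F 0 \<le> Zb * F 0"
proof -
  have "trunc_op M s F 0 \<le> (\<Sum>k=1..M. real k powr (-s) * F 0)"
    unfolding trunc_op_def by (intro sum_mono) (auto intro!: mult_left_mono cone_antimono[OF F])
  also have "\<dots> = (\<Sum>k=1..M. real k powr (-s)) * F 0" by (simp add: sum_distrib_right)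
  also have "\<dots> \<le> Zb * F 0" using assms cone_nonneg[OF F, of 0] by (intro mult_right_mono) auto
  finally show ?thesis .
qed

text \<open>The branch \<open>k = 1\<close> alone makes images of the operator strictly decreasing, and the
  branch \<open>k = 2\<close> alone makes their product with \<open>(1 + x)\<^sup>s\<close> strictly increasing.\<close>

lemma trunc_op_diff_ge:
  assumes F: "F \<in> decay_cone s" and xy: "0 \<le> x" "x \<le> y" "y \<le> 1" and s: "1 \<le> s" and M: "1 \<le> M"
  shows "F 0 * (y - x) / (3 * (2 powr s)\<^sup>2) \<le> trunc_op M s F x - trunc_op M s F y"
proof -
  define A where "A k x = (real k + x) powr (-s) * F (1 / (real k + x))" for k x
  have cA: "A k \<in> decay_cone s" if "k \<ge> 1" for k
    using cone_branch_plain[OF F, of "real k"] that s by (simp add: A_def[abs_def])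
  have "A 1 x - A 1 y \<le> (\<Sum>k=1..M. A k x - A k y)"
    using M xy cone_antimono[OF cA xy] by (intro member_le_sum) auto
  also have "\<dots> = trunc_op M s F x - trunc_op M s F y"
    by (simp add: trunc_op_def A_def sum_subtractf)
  finally have 1: "A 1 x - A 1 y \<le> trunc_op M s F x - trunc_op M s F y" .
  \<comment> \<open>The right side is the weighted \<open>F\<close> at \<open>1 / (1 + v)\<close>,
    which decreases in \<open>v\<close>. So \<open>A 1\<close> falls at least as fast as
    \<open>(2 + v) powr (-s)\<close>.\<close>
  have eq: "(2 + v) powr s * A 1 v = (1 + 1 / (1 + v)) powr s * F (1 / (1 + v))" if "0 \<le> v" for v
  proof -
    have "1 + 1 / (1 + v) = (2 + v) / (1 + v)" using that by (simp add: field_simps)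
    then show ?thesis using that by (simp add: A_def powr_divide powr_minus field_simps)
  qed
  have "(2 + y) powr s * A 1 y \<le> (2 + x) powr s * A 1 x"
    unfolding eq[OF xy(1)] eq[OF order_trans[OF xy(1,2)]]
    using xy by (intro cone_mono[OF F]) (auto intro!: frac_le)
  then have "A 1 y \<le> ((2 + x) / (2 + y)) powr s * A 1 x"
    using xy by (simp add: powr_divide field_simps)
  also have "\<dots> \<le> ((2 + x) / (2 + y)) powr 1 * A 1 x"
    using xy s by (intro mult_right_mono powr_mono' cone_nonneg[OF cA]) auto
  finally have "(1 - (2 + x) / (2 + y)) * A 1 x \<le> A 1 x - A 1 y" using xy by (simp add: algebra_simps)
  moreover have "(y - x) / 3 \<le> 1 - (2 + x) / (2 + y)"
  proof -
    have "1 - (2 + x) / (2 + y) = (y - x) / (2 + y)" using xy by (simp add: field_simps)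
    moreover have "(y - x) / 3 \<le> (y - x) / (2 + y)" using xy by (intro divide_left_mono) auto
    ultimately show ?thesis by simp
  qed
  moreover have "F 0 / (2 powr s)\<^sup>2 \<le> A 1 x"
  proof -
    have "F 0 / (2 powr s)\<^sup>2 = 2 powr (-s) * (2 powr (-s) * F 0)"
      by (simp add: powr_minus power2_eq_square field_simps)
    also have "\<dots> \<le> (1 + x) powr (-s) * F (1 / (1 + x))"
      using xy s by (intro mult_mono cone_lower[OF F] powr_mono2' mult_nonneg_nonneg cone_nonneg[OF F]) auto
    finally show ?thesis by (simp add: A_def)
  qed
  moreover from calculation(2,3) have "(y - x) / 3 * (F 0 / (2 powr s)\<^sup>2) \<le> (1 - (2 + x) / (2 + y)) * A 1 x"
    using xy cone_nonneg[OF F, of 0] by (intro mult_mono) (auto simp: divide_simps)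
  ultimately have "(y - x) / 3 * (F 0 / (2 powr s)\<^sup>2) \<le> A 1 x - A 1 y" by linarith
  with 1 show ?thesis by (simp add: mult_ac)
qed

lemma trunc_op_weighted_diff_ge:
  assumes F: "F \<in> decay_cone s" and xy: "0 \<le> x" "x \<le> y" "y \<le> 1" and s: "1 \<le> s" and M: "2 \<le> M"
  shows "F 0 * (y - x) / (9 * (2 powr s)\<^sup>2)
    \<le> (1 + y) powr s * trunc_op M s F y - (1 + x) powr s * trunc_op M s F x"
proof -
  define A where "A k x = (real k + x) powr (-s) * F (1 / (real k + x))" for k x
  have cA: "A k \<in> decay_cone s" if "k \<ge> 1" for k
    using cone_branch_plain[OF F, of "real k"] that s by (simp add: A_def[abs_def])
  have "(1 + y) powr s * A 2 y - (1 + x) powr s * A 2 x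
      \<le> (\<Sum>k=1..M. (1 + y) powr s * A k y - (1 + x) powr s * A k x)"
    using M xy cone_mono[OF cA xy]
    by (intro member_le_sum[of 2 _ "\<lambda>k. (1 + y) powr s * A k y - (1 + x) powr s * A k x"]) auto
  also have "\<dots> = (1 + y) powr s * trunc_op M s F y - (1 + x) powr s * trunc_op M s F x"
    by (simp add: trunc_op_def A_def sum_subtractf sum_distrib_left)
  finally have 1: "(1 + y) powr s * A 2 y - (1 + x) powr s * A 2 x
    \<le> (1 + y) powr s * trunc_op M s F y - (1 + x) powr s * trunc_op M s F x" .
  \<comment> \<open>By \<open>eq\<close> below, \<open>(1 + v) powr s * A 2 v\<close> is
    \<open>((1 + v) / (2 + v)) powr s\<close> times a factor that does not decrease in
    \<open>v\<close>. The base grows strictly from \<open>a\<close> to \<open>b\<close>; for the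
    branch \<open>k = 1\<close> it would be constantly 1.\<close>
  define a b where "a = (1 + x) / (2 + x)" and "b = (1 + y) / (2 + y)"
  have a: "1 / 2 \<le> a" "0 < a" using xy by (auto simp: a_def field_simps)
  have ab: "(y - x) / 9 \<le> b - a"
  proof -
    have "b - a = (y - x) / ((2 + x) * (2 + y))" using xy by (simp add: a_def b_def field_simps)
    moreover have "(2 + x) * (2 + y) \<le> 3 * 3" using xy by (intro mult_mono) auto
    moreover have "(y - x) / 9 \<le> (y - x) / ((2 + x) * (2 + y))"
      using xy calculation(2) by (intro divide_left_mono) auto
    ultimately show ?thesis by simp
  qed
  then have b: "a \<le> b" using xy by (simp add: field_simps)
  \<comment> \<open>As \<open>b / a \<ge> 1\<close> and \<open>s \<ge> 1\<close>, the growth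
    \<open>b powr s - a powr s\<close> is at least \<open>a powr (s - 1) * (b - a)\<close>, and
    \<open>a \<ge> 1 / 2\<close> bounds this below.\<close>
  have "(1 / 2) powr s * ((y - x) / 9) \<le> a powr s * (b / a - 1)"
  proof -
    have "(1 / 2) powr s \<le> (1/2) powr (s - 1)" using s by (intro powr_mono') auto
    also have "\<dots> \<le> a powr (s - 1)" using a s by (intro powr_mono2) auto
    finally have "(1 / 2) powr s * ((y - x) / 9) \<le> a powr (s - 1) * (b - a)"
      using ab xy by (intro mult_mono) auto
    also have "\<dots> = a powr s * (b / a - 1)" using a by (simp add: powr_diff field_simps)
    finally show ?thesis .
  qed
  also have "\<dots> \<le> a powr s * ((b / a) powr s - 1)"
    using powr_mono[of 1 s "b / a"] a b s by (intro mult_left_mono) (auto simp: le_divide_eq)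
  also have "\<dots> = b powr s - a powr s" using a b by (simp add: powr_divide field_simps)
  finally have bas: "(1 / 2) powr s * ((y - x) / 9) \<le> b powr s - a powr s" .
  have eq: "(1 + v) powr s * A 2 v = ((1 + v) / (2 + v)) powr s * F (1 / (2 + v))" if "0 \<le> v" for v
    using that by (simp add: A_def powr_divide powr_minus field_simps)
  have "F 0 * (y - x) / (9 * (2 powr s)\<^sup>2) = ((1 / 2) powr s * ((y - x) / 9)) * (2 powr (-s) * F 0)"
    by (simp add: powr_minus powr_divide power2_eq_square field_simps)
  also have "\<dots> \<le> (b powr s - a powr s) * F (1 / (2 + x))"
    using xy s a b
    by (intro mult_mono bas cone_lower[OF F] mult_nonneg_nonneg cone_nonneg[OF F]) (auto intro!: powr_mono2)
  also have "\<dots> \<le> b powr s * F (1 / (2 + y)) - a powr s * F (1 / (2 + x))"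
    using xy mult_left_mono[OF cone_antimono[OF F, of "1 / (2 + y)" "1 / (2 + x)"], of "b powr s"]
    by (simp add: algebra_simps frac_le)
  also have "\<dots> = (1 + y) powr s * A 2 y - (1 + x) powr s * A 2 x"
    using xy by (simp add: eq a_def b_def)
  finally show ?thesis using 1 by linarith
qed

text \<open>With \<open>T = 2 powr s\<close>, this is the quotient of the largest weighted slope
  \<open>s * T\<close> of a cone element by the least weighted slope
  \<open>1 / (9 * T\<^sup>2)\<close> of an image, times the bound \<open>Zb\<close> on the growth of
  the value at 0.\<close>

definition diam :: "real \<Rightarrow> real \<Rightarrow> real" where
  "diam s Zb = 9 * s * (2 powr s) ^ 3 * Zb"

text \<open>Finite projective diameter of the image cone: any \<open>B\<close> in the cone is dominated, in the
  order induced by the cone, by a fixed multiple of any image normalised to agree with \<open>B\<close> at 0.\<close>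

lemma cone_diameter:
  assumes F: "F \<in> decay_cone s" and B: "B \<in> decay_cone s" and s: "1 \<le> s" and M: "2 \<le> M"
    and Zb: "(\<Sum>k=1..M. real k powr (-s)) \<le> Zb"
  shows "(\<lambda>x. diam s Zb * B 0 * trunc_op M s F x - trunc_op M s F 0 * B x) \<in> decay_cone s"
proof -
  define T where "T = 2 powr s"
  define A where "A = trunc_op M s F"
  have T: "1 \<le> T" using s by (simp add: T_def ge_one_powr_ge_zero)
  have D: "diam s Zb = 9 * s * T ^ 3 * Zb" by (simp add: diam_def T_def)
  have "1 \<le> (\<Sum>k=1..M. real k powr (-s))"
    using member_le_sum[of 1 "{1..M}" "\<lambda>k. real k powr (-s)"] M by simp
  then have Z1: "1 \<le> Zb" using Zb by simp
  have cA: "A \<in> decay_cone s" using trunc_op_cone[OF F] s by (simp add: A_def)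
  have nn: "0 \<le> F 0" "0 \<le> B 0" "0 \<le> A 0" using cone_nonneg[of _ s 0] F B cA by auto
  have A0: "A 0 \<le> Zb * F 0" using trunc_op_le[OF F Zb] by (simp add: A_def)
  show ?thesis unfolding A_def[symmetric]
  proof (rule coneI)
    fix x :: real assume x: "0 \<le> x" "x \<le> 1"
    have "A 0 * B x \<le> A 0 * B 0" using x nn by (intro mult_left_mono cone_antimono[OF B]) auto
    also have "\<dots> \<le> (T * A x) * B 0"
      using cone_lower[OF cA x] s nn by (intro mult_right_mono) (auto simp: T_def powr_minus field_simps)
    also have "\<dots> \<le> (diam s Zb * A x) * B 0"
    proof (intro mult_right_mono nn cone_nonneg[OF cA x])
      have "T ^ 1 \<le> T ^ 3" using T by (intro power_increasing) auto
      then have "1 * T * 1 \<le> (9 * s) * T ^ 3 * Zb" using T s Z1 by (intro mult_mono) auto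
      then show "T \<le> diam s Zb" by (simp add: D)
    qed
    finally show "0 \<le> diam s Zb * B 0 * A x - A 0 * B x" by (simp add: mult_ac)
  next
    fix x y :: real assume xy: "0 \<le> x" "x \<le> y" "y \<le> 1"
    \<comment> \<open>The steepest descent of \<open>B\<close> is set against the guaranteed descent
      of the image; \<open>A 0 \<le> Zb * F 0\<close> puts both on the scale of \<open>F 0\<close>.
      The weighted condition below is treated likewise, and it is the one that uses up the whole of
      \<open>diam\<close>.\<close>
    have "A 0 * (B x - B y) \<le> (Zb * F 0) * (B 0 * s * (y - x))"
      using cone_diff_le[OF B xy s] cone_antimono[OF B xy] A0 nn Z1 by (intro mult_mono) auto
    also have "\<dots> = (3 * s * T\<^sup>2 * Zb * B 0) * (F 0 * (y - x) / (3 * T\<^sup>2))"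
      using T by (simp add: field_simps)
    also have "\<dots> \<le> (diam s Zb * B 0) * (A x - A y)"
    proof (rule mult_mono)
      have "T ^ 2 \<le> T ^ 3" using T by (intro power_increasing) auto
      then show "3 * s * T\<^sup>2 * Zb * B 0 \<le> diam s Zb * B 0" 
        unfolding D using T s Z1 nn by (intro mult_right_mono mult_mono) auto
      show "F 0 * (y - x) / (3 * T\<^sup>2) \<le> A x - A y"
        using trunc_op_diff_ge[OF F xy s, of M] M by (simp add: A_def T_def)
    qed (use nn T s Z1 xy D in auto)
    finally show "diam s Zb * B 0 * A y - A 0 * B y \<le> diam s Zb * B 0 * A x - A 0 * B x"
      by (simp add: algebra_simps)
    have "A 0 * ((1 + y) powr s * B y - (1 + x) powr s * B x) \<le> (Zb * F 0) * (B 0 * T * s * (y - x))"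
      using cone_weighted_diff_le[OF B xy s] cone_mono[OF B xy] A0 nn Z1
      by (intro mult_mono) (auto simp: T_def)
    also have "\<dots> = (diam s Zb * B 0) * (F 0 * (y - x) / (9 * T\<^sup>2))"
      using T by (simp add: D field_simps eval_nat_numeral)
    also have "\<dots> \<le> (diam s Zb * B 0) * ((1 + y) powr s * A y - (1 + x) powr s * A x)"
      using trunc_op_weighted_diff_ge[OF F xy s M] nn T s Z1 by (intro mult_left_mono) (auto simp: D A_def T_def)
    finally show "(1 + x) powr s * (diam s Zb * B 0 * A x - A 0 * B x)
        \<le> (1 + y) powr s * (diam s Zb * B 0 * A y - A 0 * B y)"
      by (simp add: algebra_simps)
  qed
qed

section \<open>Derivatives in the exponent\<close>


primrec pfun :: "nat \<Rightarrow> real \<Rightarrow> nat \<Rightarrow> real \<Rightarrow> real" where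
  "pfun M s 0 = (\<lambda>_. 1)"
| "pfun M s (Suc n) = trunc_op M s (pfun M s n)"

text \<open>Minus the derivative of \<open>pfun\<close> in \<open>s\<close>: with this sign every
  logarithm enters with a plus. \<open>pfun2\<close> is the second derivative. Both recursions come
  from the product rule, with the argument \<open>x\<close> held fixed.\<close>

primrec pfun1 :: "nat \<Rightarrow> real \<Rightarrow> nat \<Rightarrow> real \<Rightarrow> real" where
  "pfun1 M s 0 = (\<lambda>_. 0)"
| "pfun1 M s (Suc n) = (\<lambda>x. \<Sum>k=1..M. (real k + x) powr (-s) *
     (pfun1 M s n (1 / (real k + x)) + ln (real k + x) * pfun M s n (1 / (real k + x))))"

primrec pfun2 :: "nat \<Rightarrow> real \<Rightarrow> nat \<Rightarrow> real \<Rightarrow> real" where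
  "pfun2 M s 0 = (\<lambda>_. 0)"
| "pfun2 M s (Suc n) = (\<lambda>x. \<Sum>k=1..M. (real k + x) powr (-s) *
     (pfun2 M s n (1 / (real k + x)) + 2 * ln (real k + x) * pfun1 M s n (1 / (real k + x))
       + (ln (real k + x))\<^sup>2 * pfun M s n (1 / (real k + x))))"

lemma pfun_cone: "0 \<le> s \<Longrightarrow> pfun M s n \<in> decay_cone s"
  by (induction n) (auto intro: trunc_op_cone one_in_cone)

lemma pfun_pos:
  assumes "1 \<le> M" "0 \<le> x" shows "0 < pfun M s n x"
  using assms(2)
proof (induction n arbitrary: x)
  case (Suc n)
  then show ?case using assms(1)
    by (auto simp: trunc_op_def intro!: sum_pos mult_pos_pos)
qed auto

lemma has_derivative_pfun:
  assumes "0 \<le> x"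
  shows "((\<lambda>s. pfun M s n x) has_real_derivative - pfun1 M s n x) (at s)"
  using assms
proof (induction n arbitrary: x)
  case (Suc n)
  have "((\<lambda>s. \<Sum>k=1..M. (real k + x) powr (-s) * pfun M s n (1 / (real k + x))) has_real_derivative
      (\<Sum>k=1..M. - ((real k + x) powr (-s) *
     (pfun1 M s n (1 / (real k + x)) + ln (real k + x) * pfun M s n (1 / (real k + x)))))) (at s)"
  proof (intro DERIV_sum)
    fix k assume "k \<in> {1..M}"
    then have k: "0 < real k + x" using Suc.prems by auto
    show "((\<lambda>s. (real k + x) powr (-s) * pfun M s n (1 / (real k + x))) has_real_derivative
        - ((real k + x) powr (-s) *
          (pfun1 M s n (1 / (real k + x)) + ln (real k + x) * pfun M s n (1 / (real k + x))))) (at s)"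
      using k by (auto intro!: derivative_eq_intros Suc.IH simp: algebra_simps)
  qed
  then show ?case by (simp add: trunc_op_def sum_negf)
qed auto

lemma has_derivative_pfun1:
  assumes "0 \<le> x"
  shows "((\<lambda>s. pfun1 M s n x) has_real_derivative - pfun2 M s n x) (at s)"
  using assms
proof (induction n arbitrary: x)
  case (Suc n)
  have "((\<lambda>s. \<Sum>k=1..M. (real k + x) powr (-s) *
     (pfun1 M s n (1 / (real k + x)) + ln (real k + x) * pfun M s n (1 / (real k + x)))) has_real_derivative
      (\<Sum>k=1..M. - ((real k + x) powr (-s) *
     (pfun2 M s n (1 / (real k + x)) + 2 * ln (real k + x) * pfun1 M s n (1 / (real k + x))
       + (ln (real k + x))\<^sup>2 * pfun M s n (1 / (real k + x)))))) (at s)"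
  proof (intro DERIV_sum)
    fix k assume "k \<in> {1..M}"
    then have k: "0 < real k + x" using Suc.prems by auto
    show "((\<lambda>s. (real k + x) powr (-s) *
       (pfun1 M s n (1 / (real k + x)) + ln (real k + x) * pfun M s n (1 / (real k + x)))) has_real_derivative
       - ((real k + x) powr (-s) *
     (pfun2 M s n (1 / (real k + x)) + 2 * ln (real k + x) * pfun1 M s n (1 / (real k + x))
       + (ln (real k + x))\<^sup>2 * pfun M s n (1 / (real k + x))))) (at s)"
      using k by (auto intro!: derivative_eq_intros Suc.IH has_derivative_pfun
          simp: algebra_simps power2_eq_square)
  qed
  then show ?case by (simp add: sum_negf)
qed auto

section \<open>Contraction of order intervals and oscillation of the logarithmic derivative\<close>

lemma trunc_op_diff: "trunc_op M s (\<lambda>x. a * F x - b * G x) x = a * trunc_op M s F x - b * trunc_op M s G x"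
  by (simp add: trunc_op_def sum_subtractf sum_distrib_left right_diff_distrib mult_ac)

lemma trunc_op_ge:
  assumes F: "F \<in> decay_cone s" and M: "1 \<le> M" and s: "0 \<le> s" and x: "0 \<le> x" "x \<le> 1"
  shows "F 0 / (2 powr s)\<^sup>2 \<le> trunc_op M s F x"
proof -
  have "F 0 / (2 powr s)\<^sup>2 = 2 powr (-s) * (2 powr (-s) * F 0)"
    by (simp add: powr_minus power2_eq_square field_simps)
  also have "\<dots> \<le> (1 + x) powr (-s) * F (1 / (1 + x))"
    using x s by (intro mult_mono cone_lower[OF F] powr_mono2' mult_nonneg_nonneg cone_nonneg[OF F]) auto
  also have "\<dots> \<le> trunc_op M s F x"
    using member_le_sum[of 1 "{1..M}" "\<lambda>k. (real k + x) powr (-s) * F (1 / (real k + x))"]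
      M x cone_nonneg[OF F] by (auto simp: trunc_op_def)
  finally show ?thesis .
qed

lemma one_le_sum_powr: "1 \<le> M \<Longrightarrow> (1::real) \<le> (\<Sum>k=1..M. real k powr (-s))"
  using member_le_sum[of 1 "{1..M}" "\<lambda>k. real k powr (-s)"] by simp

lemma diam_ge_one:
  assumes "1 \<le> s" "1 \<le> Zb" shows "1 \<le> diam s Zb"
proof -
  have "1 \<le> 2 powr s" using assms by (simp add: ge_one_powr_ge_zero)
  then have "1 * 1 ^ 3 * 1 \<le> (9 * s) * (2 powr s) ^ 3 * Zb"
    using assms by (intro mult_mono power_mono) auto
  then show ?thesis by (simp add: diam_def)
qed

text \<open>Birkhoff's contraction argument in the order induced by the cone.\<close>

lemma bracket_contraction:
  assumes f: "f \<in> decay_cone s" and f0: "0 < trunc_op M s f 0"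
    and lo: "(\<lambda>x. F x - \<alpha> * f x) \<in> decay_cone s" and up: "(\<lambda>x. \<beta> * f x - F x) \<in> decay_cone s"
    and s: "1 \<le> s" and M: "2 \<le> M" and Zb: "(\<Sum>k=1..M. real k powr (-s)) \<le> Zb"
  obtains \<alpha>' \<beta>' where
    "(\<lambda>x. trunc_op M s F x - \<alpha>' * trunc_op M s f x) \<in> decay_cone s"
    "(\<lambda>x. \<beta>' * trunc_op M s f x - trunc_op M s F x) \<in> decay_cone s"
    "\<beta>' - \<alpha>' = (1 - 1 / diam s Zb) * (\<beta> - \<alpha>)"
proof -
  define g G D where "g = trunc_op M s f" and "G = trunc_op M s F" and "D = diam s Zb"
  have D: "1 \<le> D" using diam_ge_one s one_le_sum_powr[of M s] Zb M by (simp add: D_def)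
  have g: "g \<in> decay_cone s" using trunc_op_cone[OF f] s by (simp add: g_def)
  have g0: "0 < g 0" using f0 by (simp add: g_def)
  have L1: "trunc_op M s (\<lambda>x. F x - \<alpha> * f x) x = G x - \<alpha> * g x" for x
    using trunc_op_diff[of M s 1 F \<alpha> f x] by (simp add: G_def g_def)
  have L2: "trunc_op M s (\<lambda>x. \<beta> * f x - F x) x = \<beta> * g x - G x" for x
    using trunc_op_diff[of M s \<beta> f 1 F x] by (simp add: G_def g_def)
  \<comment> \<open>The diameter bound lets each end of the bracket move inwards by the fraction
    \<open>1 / D\<close> of its gap to \<open>G 0 / g 0\<close>. The two gaps add up to
    \<open>\<beta> - \<alpha>\<close>.\<close>
  define \<alpha>' \<beta>' where "\<alpha>' = \<alpha> + (G 0 - \<alpha> * g 0) / (D * g 0)" and "\<beta>' = \<beta> - (\<beta> * g 0 - G 0) / (D * g 0)"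
  have "(\<lambda>x. D * g 0 * (G x - \<alpha> * g x) - (G 0 - \<alpha> * g 0) * g x) \<in> decay_cone s"
    using cone_diameter[OF lo g s M Zb] unfolding L1 D_def by simp
  then have "(\<lambda>x. 1 / (D * g 0) * (D * g 0 * (G x - \<alpha> * g x) - (G 0 - \<alpha> * g 0) * g x)) \<in> decay_cone s"
    using D g0 by (intro cone_cmult) auto
  also have "(\<lambda>x. 1 / (D * g 0) * (D * g 0 * (G x - \<alpha> * g x) - (G 0 - \<alpha> * g 0) * g x)) = (\<lambda>x. G x - \<alpha>' * g x)"
    using D g0 by (intro ext) (simp add: \<alpha>'_def field_simps)
  finally have 1: "(\<lambda>x. G x - \<alpha>' * g x) \<in> decay_cone s" .
  have "(\<lambda>x. D * g 0 * (\<beta> * g x - G x) - (\<beta> * g 0 - G 0) * g x) \<in> decay_cone s"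
    using cone_diameter[OF up g s M Zb] unfolding L2 D_def by simp
  then have "(\<lambda>x. 1 / (D * g 0) * (D * g 0 * (\<beta> * g x - G x) - (\<beta> * g 0 - G 0) * g x)) \<in> decay_cone s"
    using D g0 by (intro cone_cmult) auto
  also have "(\<lambda>x. 1 / (D * g 0) * (D * g 0 * (\<beta> * g x - G x) - (\<beta> * g 0 - G 0) * g x)) = (\<lambda>x. \<beta>' * g x - G x)"
    using D g0 by (intro ext) (simp add: \<beta>'_def field_simps)
  finally have 2: "(\<lambda>x. \<beta>' * g x - G x) \<in> decay_cone s" .
  have 3: "\<beta>' - \<alpha>' = (1 - 1 / D) * (\<beta> - \<alpha>)"
    using D g0 by (simp add: \<alpha>'_def \<beta>'_def field_simps)
  show ?thesis using that 1 2 3 unfolding g_def G_def D_def by blast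
qed

text \<open>With \<open>D = diam s Zb\<close>, the fixed point of the map sending \<open>w\<close>
  to \<open>(1 - 1 / D) * w + D * ((2 powr s)\<^sup>2 * Lb)\<close>, which bounds the change of the
  bracket width under one application of the operator.\<close>

definition osc_bound :: "real \<Rightarrow> real \<Rightarrow> real \<Rightarrow> real" where
  "osc_bound s Zb Lb = (diam s Zb)\<^sup>2 * ((2 powr s)\<^sup>2 * Lb)"

text \<open>The quotient of \<open>pfun1\<close> by \<open>pfun\<close> is minus the logarithmic
  derivative, so this bounds its oscillation in \<open>x\<close> uniformly in \<open>n\<close>. One
  application contracts the old bracket and adds the logarithmic term, whose own bracket has bounded
  width; the fixed point \<open>osc_bound\<close> is therefore never exceeded.\<close>

lemma pfun1_bracket:
  assumes s: "1 \<le> s" and M: "2 \<le> M" and Zb: "(\<Sum>k=1..M. real k powr (-s)) \<le> Zb"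
    and Lb: "(\<Sum>k=1..M. (ln (real k) + 2) * real k powr (-s)) \<le> Lb"
  shows "\<exists>\<alpha> \<beta>. (\<lambda>x. pfun1 M s n x - \<alpha> * pfun M s n x) \<in> decay_cone s \<and>
    (\<lambda>x. \<beta> * pfun M s n x - pfun1 M s n x) \<in> decay_cone s \<and> \<beta> - \<alpha> \<le> osc_bound s Zb Lb"
proof (induction n)
  case 0
  have "0 \<le> (\<Sum>k=1..M. (ln (real k) + 2) * real k powr (-s))"
    by (intro sum_nonneg mult_nonneg_nonneg) auto
  then have "0 \<le> osc_bound s Zb Lb" using Lb by (simp add: osc_bound_def)
  moreover have "(\<lambda>_. 0) \<in> decay_cone s" by (simp add: decay_cone_def)
  ultimately show ?case by (intro exI[of _ 0]) auto
next
  case (Suc n)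
  define f where "f = pfun M s n"
  define D where "D = diam s Zb"
  have D: "1 \<le> D" using diam_ge_one s one_le_sum_powr[of M s] Zb M by (simp add: D_def)
  have f: "f \<in> decay_cone s" using pfun_cone s by (simp add: f_def)
  have g: "trunc_op M s f \<in> decay_cone s" using trunc_op_cone[OF f] s by simp
  have g0: "0 < trunc_op M s f 0" using pfun_pos[of M 0 s "Suc n"] M by (simp add: f_def)
  obtain \<alpha> \<beta> where ab: "(\<lambda>x. pfun1 M s n x - \<alpha> * f x) \<in> decay_cone s"
    "(\<lambda>x. \<beta> * f x - pfun1 M s n x) \<in> decay_cone s" "\<beta> - \<alpha> \<le> osc_bound s Zb Lb"
    using Suc.IH by (auto simp: f_def)
  obtain \<alpha>' \<beta>' where ab': "(\<lambda>x. trunc_op M s (pfun1 M s n) x - \<alpha>' * trunc_op M s f x) \<in> decay_cone s"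
    "(\<lambda>x. \<beta>' * trunc_op M s f x - trunc_op M s (pfun1 M s n) x) \<in> decay_cone s"
    "\<beta>' - \<alpha>' = (1 - 1 / D) * (\<beta> - \<alpha>)"
    using bracket_contraction[OF f g0 ab(1,2) s M Zb] unfolding D_def by blast
  define B where "B = (\<lambda>x. \<Sum>k=1..M. (ln (real k + x) + 2) * ((real k + x) powr (-s) * f (1 / (real k + x))))"
  have cB: "B \<in> decay_cone s" unfolding B_def by (rule log_branch_in_cone[OF f s])
  \<comment> \<open>The logarithmic term is the cone element \<open>B\<close> minus twice the image
    of \<open>f\<close>; the latter only shifts both ends of the bracket by 2.\<close>
  have pfun1: "pfun1 M s (Suc n) x = trunc_op M s (pfun1 M s n) x + (B x - 2 * trunc_op M s f x)" for x
    by (simp add: B_def trunc_op_def f_def algebra_simps sum.distrib sum_distrib_left)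
  have B0: "B 0 \<le> (2 powr s)\<^sup>2 * Lb * trunc_op M s f 0"
  proof -
    have "B 0 \<le> (\<Sum>k=1..M. (ln (real k) + 2) * real k powr (-s) * f 0)"
      unfolding B_def by (intro sum_mono) (auto simp: mult.assoc intro!: mult_left_mono cone_antimono[OF f])
    also have "\<dots> = (\<Sum>k=1..M. (ln (real k) + 2) * real k powr (-s)) * f 0"
      by (simp add: sum_distrib_right)
    also have "\<dots> \<le> Lb * ((2 powr s)\<^sup>2 * trunc_op M s f 0)"
    proof (rule mult_mono)
      show "f 0 \<le> (2 powr s)\<^sup>2 * trunc_op M s f 0"
        using trunc_op_ge[OF f, of M 0] M s by (simp add: field_simps)
      have "0 \<le> (\<Sum>k=1..M. (ln (real k) + 2) * real k powr (-s))"
        by (intro sum_nonneg mult_nonneg_nonneg) auto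
      then show "0 \<le> Lb" using Lb by simp
    qed (use Lb cone_nonneg[OF f, of 0] in auto)
    finally show ?thesis by (simp add: mult_ac)
  qed
  \<comment> \<open>In the order of the cone the diameter bound places \<open>B\<close> below
    \<open>\<gamma>\<close> times the image of \<open>f\<close>. Its lower bracket is 0, as
    \<open>B\<close> is in the cone.\<close>
  define \<gamma> where "\<gamma> = D * B 0 / trunc_op M s f 0"
  have "(\<lambda>x. D * B 0 * trunc_op M s f x - trunc_op M s f 0 * B x) \<in> decay_cone s"
    using cone_diameter[OF f cB s M Zb] by (simp add: D_def)
  then have "(\<lambda>x. 1 / trunc_op M s f 0 * (D * B 0 * trunc_op M s f x - trunc_op M s f 0 * B x)) \<in> decay_cone s"
    using g0 by (intro cone_cmult) auto
  also have "(\<lambda>x. 1 / trunc_op M s f 0 * (D * B 0 * trunc_op M s f x - trunc_op M s f 0 * B x)) = (\<lambda>x. \<gamma> * trunc_op M s f x - B x)"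
    using g0 by (intro ext) (simp add: \<gamma>_def field_simps)
  finally have upB: "(\<lambda>x. \<gamma> * trunc_op M s f x - B x) \<in> decay_cone s" .
  have lo: "(\<lambda>x. pfun1 M s (Suc n) x - (\<alpha>' - 2) * pfun M s (Suc n) x) \<in> decay_cone s"
    using cone_add[OF ab'(1) cB] unfolding pfun1 pfun.simps f_def[symmetric] by (simp add: algebra_simps)
  have up: "(\<lambda>x. (\<beta>' + \<gamma> - 2) * pfun M s (Suc n) x - pfun1 M s (Suc n) x) \<in> decay_cone s"
    using cone_add[OF ab'(2) upB] unfolding pfun1 pfun.simps f_def[symmetric] by (simp add: algebra_simps)
  have "\<gamma> \<le> D * ((2 powr s)\<^sup>2 * Lb)" 
    using B0 g0 D by (simp add: \<gamma>_def field_simps)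
  moreover have "(1 - 1 / D) * (\<beta> - \<alpha>) \<le> (1 - 1 / D) * osc_bound s Zb Lb"
    using ab(3) D by (intro mult_left_mono) auto
  moreover have "(1 - 1 / D) * osc_bound s Zb Lb + D * ((2 powr s)\<^sup>2 * Lb) = osc_bound s Zb Lb"
    using D by (simp add: osc_bound_def D_def[symmetric] power2_eq_square field_simps)
  ultimately have "(\<beta>' + \<gamma> - 2) - (\<alpha>' - 2) \<le> osc_bound s Zb Lb" using ab'(3) by linarith
  with lo up show ?case by blast
qed

section \<open>Variance bounds for the second logarithmic derivative\<close>

text \<open>The sum of \<open>w i * (a i - m)\<^sup>2\<close> is least at the weighted mean, where
  it equals the variance. The first claim compares with an arbitrary \<open>m\<close>; the second is
  Cauchy-Schwarz, nonnegativity of the variance.\<close>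

lemma weighted_variance:
  fixes w a :: "'i \<Rightarrow> real"
  assumes "0 < sum w I"
  shows "(\<Sum>i\<in>I. w i * (a i)\<^sup>2) \<le> (\<Sum>i\<in>I. w i * a i)\<^sup>2 / sum w I + (\<Sum>i\<in>I. w i * (a i - m)\<^sup>2)"
    and "(\<And>i. i \<in> I \<Longrightarrow> 0 \<le> w i) \<Longrightarrow> (\<Sum>i\<in>I. w i * a i)\<^sup>2 / sum w I \<le> (\<Sum>i\<in>I. w i * (a i)\<^sup>2)"
proof -
  define S A where "S = sum w I" and "A = (\<Sum>i\<in>I. w i * a i)"
  have S: "0 < S" using assms by (simp add: S_def)
  have eq: "(\<Sum>i\<in>I. w i * (a i - m)\<^sup>2) = (\<Sum>i\<in>I. w i * (a i)\<^sup>2) - 2 * m * A + m\<^sup>2 * S" for m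
    by (simp add: power2_diff S_def A_def algebra_simps sum.distrib sum_subtractf sum_distrib_left sum_distrib_right)
  have "0 \<le> (A - m * S)\<^sup>2 / S" using S by simp
  also have "\<dots> = A\<^sup>2 / S - 2 * m * A + m\<^sup>2 * S" using S by (simp add: power2_eq_square field_simps)
  finally show "(\<Sum>i\<in>I. w i * (a i)\<^sup>2) \<le> (\<Sum>i\<in>I. w i * a i)\<^sup>2 / sum w I + (\<Sum>i\<in>I. w i * (a i - m)\<^sup>2)"
    using eq[of m] by (simp add: S_def[symmetric] A_def[symmetric])
  assume "\<And>i. i \<in> I \<Longrightarrow> 0 \<le> w i"
  then have "0 \<le> (\<Sum>i\<in>I. w i * (a i - A / S)\<^sup>2)" by (intro sum_nonneg) auto
  then have "0 \<le> (\<Sum>i\<in>I. w i * (a i)\<^sup>2) - A\<^sup>2 / S"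
    using S unfolding eq by (simp add: power2_eq_square field_simps)
  then show "(\<Sum>i\<in>I. w i * a i)\<^sup>2 / sum w I \<le> (\<Sum>i\<in>I. w i * (a i)\<^sup>2)"
    by (simp add: S_def A_def)
qed

text \<open>This says that \<open>ln (pfun M s n x)\<close> has nonnegative second derivative in
  \<open>s\<close>. With weights \<open>w k\<close> for the branches and
  \<open>u k + ln (z k)\<close> for minus their logarithmic derivatives, Cauchy-Schwarz over the
  branches combines with the induction hypothesis inside each branch.\<close>

lemma pfun_logconvex:
  assumes "1 \<le> M" "0 \<le> x"
  shows "(pfun1 M s n x)\<^sup>2 / pfun M s n x \<le> pfun2 M s n x"
  using assms(2)
proof (induction n arbitrary: x)
  case (Suc n)
  define z w u where "z k = real k + x" and "w k = z k powr (-s) * pfun M s n (1 / z k)"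
    and "u k = pfun1 M s n (1 / z k) / pfun M s n (1 / z k)" for k
  have z: "0 \<le> 1 / z k" for k using Suc.prems by (simp add: z_def)
  have p: "0 < pfun M s n (1 / z k)" for k using pfun_pos[OF assms(1) z] .
  have S: "sum w {1..M} = pfun M s (Suc n) x" by (simp add: w_def z_def trunc_op_def)
  have wa: "(\<Sum>k=1..M. w k * (u k + ln (z k))) = pfun1 M s (Suc n) x"
    unfolding pfun1.simps
  proof (intro sum.cong refl)
    show "w k * (u k + ln (z k)) = (real k + x) powr - s * (pfun1 M s n (1 / (real k + x)) + ln (real k + x) * pfun M s n (1 / (real k + x)))" for k
      unfolding z_def[symmetric] using p[of k] by (simp add: w_def u_def field_simps)
  qed
  have "(pfun1 M s (Suc n) x)\<^sup>2 / pfun M s (Suc n) x \<le> (\<Sum>k=1..M. w k * (u k + ln (z k))\<^sup>2)"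
    unfolding wa[symmetric] S[symmetric]
  proof (rule weighted_variance(2))
    show "0 < sum w {1..M}" unfolding S by (rule pfun_pos[OF assms(1) Suc.prems])
    show "0 \<le> w k" for k using p[of k] by (simp add: w_def)
  qed
  also have "\<dots> \<le> pfun2 M s (Suc n) x" unfolding pfun2.simps
  proof (intro sum_mono)
    fix k
    have "w k * (u k + ln (z k))\<^sup>2 = z k powr (-s) * ((pfun1 M s n (1 / z k))\<^sup>2 / pfun M s n (1 / z k)
        + 2 * ln (z k) * pfun1 M s n (1 / z k) + (ln (z k))\<^sup>2 * pfun M s n (1 / z k))"
      using p[of k] by (simp add: w_def u_def power2_eq_square field_simps)
    also have "\<dots> \<le> z k powr (-s) * (pfun2 M s n (1 / z k)
        + 2 * ln (z k) * pfun1 M s n (1 / z k) + (ln (z k))\<^sup>2 * pfun M s n (1 / z k))"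
      using Suc.IH[OF z] by (intro mult_left_mono) auto
    finally show "w k * (u k + ln (z k))\<^sup>2 \<le> (real k + x) powr - s *
         (pfun2 M s n (1 / (real k + x)) + 2 * ln (real k + x) * pfun1 M s n (1 / (real k + x)) +
          (ln (real k + x))\<^sup>2 * pfun M s n (1 / (real k + x)))"
      by (simp add: z_def)
  qed
  finally show ?case .
qed auto

text \<open>The counterpart of \<open>pfun_logconvex\<close> from above. As in the law of total
  variance, one application of the operator adds to the second logarithmic derivative only the
  variance of \<open>u k + ln (z k)\<close> over the branches, and \<open>K\<close> bounds
  it.\<close>

lemma pfun_variance:
  assumes s: "1 \<le> s" and M: "2 \<le> M" and Zb: "(\<Sum>k=1..M. real k powr (-s)) \<le> Zb"
    and Lb: "(\<Sum>k=1..M. (ln (real k) + 2) * real k powr (-s)) \<le> Lb"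
    and Hb: "(\<Sum>k=1..M. (ln (real k + 1))\<^sup>2 * real k powr (-s)) \<le> Hb"
    and K: "K = 2 * (osc_bound s Zb Lb)\<^sup>2 + 2 * (2 powr s)\<^sup>2 * Hb"
    and x: "0 \<le> x" "x \<le> 1"
  shows "pfun2 M s n x \<le> (pfun1 M s n x)\<^sup>2 / pfun M s n x + real n * K * pfun M s n x"
  using x
proof (induction n arbitrary: x)
  case (Suc n)
  have M1: "1 \<le> M" using M by simp
  define f where "f = pfun M s n"
  have f: "f \<in> decay_cone s" using pfun_cone s by (simp add: f_def)
  define z w u where "z k = real k + x" and "w k = z k powr (-s) * f (1 / z k)"
    and "u k = pfun1 M s n (1 / z k) / f (1 / z k)" for k
  have z: "1 \<le> z k" "0 \<le> 1 / z k" "1 / z k \<le> 1" if "k \<in> {1..M}" for k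
    using Suc.prems that by (auto simp: z_def)
  have p: "0 < f (1 / z k)" for k using pfun_pos[OF M1, of "1 / z k"] Suc.prems by (simp add: z_def f_def)
  have S: "sum w {1..M} = pfun M s (Suc n) x" by (simp add: w_def z_def trunc_op_def f_def)
  have Spos: "0 < sum w {1..M}" unfolding S by (rule pfun_pos[OF M1 Suc.prems(1)])
  have wa: "(\<Sum>k=1..M. w k * (u k + ln (z k))) = pfun1 M s (Suc n) x"
    unfolding pfun1.simps
  proof (intro sum.cong refl)
    show "w k * (u k + ln (z k)) = (real k + x) powr - s * (pfun1 M s n (1 / (real k + x)) + ln (real k + x) * pfun M s n (1 / (real k + x)))" for k
      unfolding z_def[symmetric] f_def[symmetric] using p[of k] by (simp add: w_def u_def field_simps)
  qed
  obtain \<alpha> \<beta> where ab: "(\<lambda>x. pfun1 M s n x - \<alpha> * f x) \<in> decay_cone s"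
    "(\<lambda>x. \<beta> * f x - pfun1 M s n x) \<in> decay_cone s" "\<beta> - \<alpha> \<le> osc_bound s Zb Lb"
    using pfun1_bracket[OF s M Zb Lb, of n] by (auto simp: f_def)
  have u: "0 \<le> u k - \<alpha>" "u k - \<alpha> \<le> osc_bound s Zb Lb" if "k \<in> {1..M}" for k
  proof -
    have "\<alpha> * f (1 / z k) \<le> pfun1 M s n (1 / z k)" "pfun1 M s n (1 / z k) \<le> \<beta> * f (1 / z k)"
      using cone_nonneg[OF ab(1) z(2,3)[OF that]] cone_nonneg[OF ab(2) z(2,3)[OF that]] by auto
    then have "\<alpha> \<le> u k" "u k \<le> \<beta>" using p[of k] by (auto simp: u_def field_simps)
    then show "0 \<le> u k - \<alpha>" "u k - \<alpha> \<le> osc_bound s Zb Lb" using ab(3) by auto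
  qed
  have "pfun2 M s (Suc n) x \<le> (\<Sum>k=1..M. w k * (u k + ln (z k))\<^sup>2 + real n * K * w k)"
    unfolding pfun2.simps
  proof (intro sum_mono)
    fix k assume k: "k \<in> {1..M}"
    have "(real k + x) powr - s *
         (pfun2 M s n (1 / (real k + x)) + 2 * ln (real k + x) * pfun1 M s n (1 / (real k + x)) +
          (ln (real k + x))\<^sup>2 * pfun M s n (1 / (real k + x)))
       = z k powr (-s) * (pfun2 M s n (1 / z k)
        + 2 * ln (z k) * pfun1 M s n (1 / z k) + (ln (z k))\<^sup>2 * f (1 / z k))"
      by (simp add: z_def f_def)
    also have "\<dots> \<le> z k powr (-s) * (((pfun1 M s n (1 / z k))\<^sup>2 / f (1 / z k) + real n * K * f (1 / z k))
        + 2 * ln (z k) * pfun1 M s n (1 / z k) + (ln (z k))\<^sup>2 * f (1 / z k))"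
      using Suc.IH[OF z(2,3)[OF k]] by (intro mult_left_mono) (auto simp: f_def)
    also have "\<dots> = w k * (u k + ln (z k))\<^sup>2 + real n * K * w k"
      using p[of k] by (simp add: w_def u_def power2_eq_square field_simps)
    finally show "(real k + x) powr - s *
         (pfun2 M s n (1 / (real k + x)) + 2 * ln (real k + x) * pfun1 M s n (1 / (real k + x)) +
          (ln (real k + x))\<^sup>2 * pfun M s n (1 / (real k + x))) \<le> w k * (u k + ln (z k))\<^sup>2 + real n * K * w k" .
  qed
  also have "\<dots> = (\<Sum>k=1..M. w k * (u k + ln (z k))\<^sup>2) + real n * K * pfun M s (Suc n) x"
    unfolding S[symmetric] by (simp add: sum.distrib sum_distrib_left)
  also have "(\<Sum>k=1..M. w k * (u k + ln (z k))\<^sup>2)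
      \<le> (pfun1 M s (Suc n) x)\<^sup>2 / pfun M s (Suc n) x + (\<Sum>k=1..M. w k * ((u k + ln (z k)) - \<alpha>)\<^sup>2)"
    using weighted_variance(1)[OF Spos, of "\<lambda>k. u k + ln (z k)" \<alpha>] unfolding wa S .
  \<comment> \<open>Centering at \<open>\<alpha>\<close> instead of the mean makes
    \<open>u k - \<alpha>\<close> at most \<open>osc_bound\<close>. The logarithms have a finite
    second moment \<open>Hb\<close>, once \<open>f 0\<close> is compared with the next iterate
    through the branch \<open>k = 1\<close>.\<close>
  also have "(\<Sum>k=1..M. w k * ((u k + ln (z k)) - \<alpha>)\<^sup>2) \<le> K * pfun M s (Suc n) x"
  proof -
    have "(\<Sum>k=1..M. w k * ((u k + ln (z k)) - \<alpha>)\<^sup>2)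
        \<le> (\<Sum>k=1..M. 2 * (osc_bound s Zb Lb)\<^sup>2 * w k + 2 * ((ln (real k + 1))\<^sup>2 * real k powr (-s)) * f 0)"
    proof (intro sum_mono)
      fix k assume k: "k \<in> {1..M}"
      have lnz: "0 \<le> ln (z k)" "ln (z k) \<le> ln (real k + 1)"
        using z(1)[OF k] Suc.prems k by (auto simp: z_def)
      have "((u k + ln (z k)) - \<alpha>)\<^sup>2 = ((u k - \<alpha>) + ln (z k))\<^sup>2" by (simp add: algebra_simps)
      also have "\<dots> \<le> 2 * (u k - \<alpha>)\<^sup>2 + 2 * (ln (z k))\<^sup>2"
        using zero_le_power2[of "(u k - \<alpha>) - ln (z k)"] by (simp add: power2_eq_square algebra_simps)
      also have "\<dots> \<le> 2 * (osc_bound s Zb Lb)\<^sup>2 + 2 * (ln (real k + 1))\<^sup>2"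
        using u[OF k] lnz by (intro add_mono mult_left_mono power_mono) auto
      finally have "w k * ((u k + ln (z k)) - \<alpha>)\<^sup>2 \<le> w k * (2 * (osc_bound s Zb Lb)\<^sup>2 + 2 * (ln (real k + 1))\<^sup>2)"
        using p[of k] by (intro mult_left_mono) (auto simp: w_def)
      moreover have "w k * (ln (real k + 1))\<^sup>2 \<le> (real k powr (-s) * f 0) * (ln (real k + 1))\<^sup>2"
        using k Suc.prems s z[OF k] p[of k] unfolding w_def
        by (intro mult_right_mono mult_mono cone_antimono[OF f] powr_mono2') (auto simp: z_def)
      ultimately show "w k * ((u k + ln (z k)) - \<alpha>)\<^sup>2
          \<le> 2 * (osc_bound s Zb Lb)\<^sup>2 * w k + 2 * ((ln (real k + 1))\<^sup>2 * real k powr (-s)) * f 0"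
        by (simp add: algebra_simps)
    qed
    also have "\<dots> = 2 * (osc_bound s Zb Lb)\<^sup>2 * pfun M s (Suc n) x
        + 2 * ((\<Sum>k=1..M. (ln (real k + 1))\<^sup>2 * real k powr (-s)) * f 0)"
      unfolding S[symmetric] by (simp add: sum.distrib sum_distrib_left sum_distrib_right mult_ac)
    also have "(\<Sum>k=1..M. (ln (real k + 1))\<^sup>2 * real k powr (-s)) * f 0
        \<le> Hb * ((2 powr s)\<^sup>2 * pfun M s (Suc n) x)"
    proof (rule mult_mono)
      show "f 0 \<le> (2 powr s)\<^sup>2 * pfun M s (Suc n) x"
        using trunc_op_ge[OF f M1 _ Suc.prems] s by (simp add: field_simps f_def)
      have "0 \<le> (\<Sum>k=1..M. (ln (real k + 1))\<^sup>2 * real k powr (-s))" by (intro sum_nonneg) auto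
      then show "0 \<le> Hb" using Hb by simp
    qed (use Hb cone_nonneg[OF f, of 0] in auto)
    finally show ?thesis by (simp add: K algebra_simps)
  qed
  finally show ?case by (simp add: algebra_simps)
qed auto

section \<open>Partition sums and the pressure\<close>


lemma cone_cong:
  assumes "F \<in> decay_cone s" "\<And>x. 0 \<le> x \<Longrightarrow> x \<le> 1 \<Longrightarrow> G x = F x"
  shows "G \<in> decay_cone s"
  using assms unfolding decay_cone_def by auto

section \<open>Words, continued fraction products and iterates of the operator\<close>

text \<open>For positive letters this is the reciprocal of the continuant expression
  \<open>q_n + x * q_(n-1)\<close>; its square is the absolute value of the derivative of
  \<open>cfrac_tail ws\<close> at \<open>x\<close>.\<close>

definition wprod :: "nat list \<Rightarrow> real \<Rightarrow> real" where
  "wprod ws x = (\<Prod>j<length ws. cfrac_tail (drop j ws) x)"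

lemma cfrac_tail_snoc: "cfrac_tail (ws @ [k]) x = cfrac_tail ws (1 / (real k + x))"
  by (induction ws) auto

text \<open>A letter added at the inner end replaces \<open>x\<close> by \<open>1 / (k + x)\<close>
  in all earlier tails and contributes one new tail. This is one application of the operator, so
  inductions on words run from the right.\<close>

lemma wprod_snoc: "wprod (ws @ [k]) x = wprod ws (1 / (real k + x)) * (1 / (real k + x))"
proof -
  have "(\<Prod>j<length ws. cfrac_tail (drop j (ws @ [k])) x) = (\<Prod>j<length ws. cfrac_tail (drop j ws) (1 / (real k + x)))"
    by (intro prod.cong) (auto simp: cfrac_tail_snoc)
  then show ?thesis by (simp add: wprod_def)
qed

lemma cfrac_tail_nonneg: "0 \<le> x \<Longrightarrow> 0 \<le> cfrac_tail ws x"
  by (induction ws) auto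

lemma cfrac_tail_pos: "0 \<le> x \<Longrightarrow> ws \<noteq> [] \<Longrightarrow> \<forall>w\<in>set ws. 1 \<le> w \<Longrightarrow> 0 < cfrac_tail ws x"
  using cfrac_tail_nonneg[of x "tl ws"] by (cases ws) (auto intro!: add_pos_nonneg)

lemma wprod_pos:
  assumes "0 \<le> x" "\<forall>w\<in>set ws. 1 \<le> w" shows "0 < wprod ws x"
  unfolding wprod_def using assms by (intro prod_pos cfrac_tail_pos) (auto dest: in_set_dropD)

text \<open>A word acts as a composition of branches at exponent 1. What is needed later is the
  decrease in \<open>x\<close>.\<close>

lemma wprod_in_cone:
  assumes "\<forall>w\<in>set ws. 1 \<le> w" shows "wprod ws \<in> decay_cone 1"
  using assms
proof (induction ws rule: rev_induct)
  case Nil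
  then show ?case using one_in_cone[of 1] by (simp add: wprod_def[abs_def])
next
  case (snoc k ws)
  show ?case
    by (rule cone_cong[OF cone_branch_plain[of "wprod ws" 1 "real k"]])
      (use snoc in \<open>auto simp: wprod_snoc powr_minus divide_inverse\<close>)
qed

text \<open>The product decreases in \<open>x\<close> and \<open>s\<close> is nonnegative, so the
  supremum is attained at 0.\<close>

lemma exp_sup_ln_wprod:
  assumes ws: "ws \<in> words n" and s: "0 \<le> s"
  shows "exp (SUP x\<in>{0..1}. ln (\<Prod>j<n. cfrac_tail (drop j ws) x powr s)) = wprod ws 0 powr s"
proof -
  have n: "length ws = n" and pos: "\<forall>w\<in>set ws. 1 \<le> w" using ws by (auto simp: words_def)
  have eq: "ln (\<Prod>j<n. cfrac_tail (drop j ws) x powr s) = s * ln (wprod ws x)" if "0 \<le> x" for x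
  proof -
    have "(\<Prod>j<n. cfrac_tail (drop j ws) x powr s) = wprod ws x powr s"
      unfolding wprod_def n by (rule prod_powr_distrib[symmetric])
    then show ?thesis using wprod_pos[OF that pos] by (simp add: ln_powr)
  qed
  have "(SUP x\<in>{0..1}. ln (\<Prod>j<n. cfrac_tail (drop j ws) x powr s)) = s * ln (wprod ws 0)"
  proof (rule cSup_eq_maximum)
    show "s * ln (wprod ws 0) \<in> (\<lambda>x. ln (\<Prod>j<n. cfrac_tail (drop j ws) x powr s)) ` {0..1}"
      using eq[of 0] by (intro image_eqI[of _ _ 0]) auto
    fix y assume "y \<in> (\<lambda>x. ln (\<Prod>j<n. cfrac_tail (drop j ws) x powr s)) ` {0..1}"
    then obtain x where x: "0 \<le> x" "x \<le> 1" "y = s * ln (wprod ws x)" using eq by auto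
    have "wprod ws x \<le> wprod ws 0" using cone_antimono[OF wprod_in_cone[OF pos]] x by simp
    then show "y \<le> s * ln (wprod ws 0)"
      using x s wprod_pos[OF x(1) pos] wprod_pos[OF _ pos, of 0] by (auto intro!: mult_left_mono)
  qed
  then show ?thesis using wprod_pos[OF _ pos, of 0] by (simp add: powr_def)
qed

definition twords :: "nat \<Rightarrow> nat \<Rightarrow> nat list set" where
  "twords M n = {ws. set ws \<subseteq> {1..M} \<and> length ws = n}"

lemma finite_twords [simp]: "finite (twords M n)"
  unfolding twords_def by (rule finite_lists_length_eq) auto

lemma pfun_eq_sum_twords:
  assumes "0 \<le> x" shows "pfun M s n x = (\<Sum>ws\<in>twords M n. wprod ws x powr s)"
  using assms
proof (induction n arbitrary: x)
  case 0
  have "twords M 0 = {[]}" by (auto simp: twords_def)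
  then show ?case by (simp add: wprod_def)
next
  case (Suc n)
  have "bij_betw (\<lambda>(k, ws). ws @ [k]) ({1..M} \<times> twords M n) (twords M (Suc n))"
  proof (rule bij_betwI[where g = "\<lambda>ws. (last ws, butlast ws)"])
    show "(\<lambda>ws. (last ws, butlast ws)) \<in> twords M (Suc n) \<rightarrow> {1..M} \<times> twords M n"
    proof
      fix ws assume "ws \<in> twords M (Suc n)"
      then show "(last ws, butlast ws) \<in> {1..M} \<times> twords M n"
        by (cases ws rule: rev_cases) (auto simp: twords_def)
    qed
    fix ws assume "ws \<in> twords M (Suc n)"
    then show "(case (last ws, butlast ws) of (k, ws) \<Rightarrow> ws @ [k]) = ws"
      by (cases ws rule: rev_cases) (auto simp: twords_def)
  qed (auto simp: twords_def)
  then have "(\<Sum>ws\<in>twords M (Suc n). wprod ws x powr s)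
      = (\<Sum>(k, ws)\<in>{1..M} \<times> twords M n. wprod (ws @ [k]) x powr s)"
    by (subst sum.reindex_bij_betw[symmetric]) (auto simp: case_prod_unfold)
  also have "\<dots> = (\<Sum>k=1..M. \<Sum>ws\<in>twords M n. wprod (ws @ [k]) x powr s)"
    by (rule sum.cartesian_product[symmetric])
  also have "\<dots> = pfun M s (Suc n) x"
    unfolding pfun.simps trunc_op_def
  proof (intro sum.cong refl)
    fix k assume "k \<in> {1..M}"
    then have z: "0 < real k + x" using Suc.prems by auto
    have "wprod (ws @ [k]) x powr s = (real k + x) powr (-s) * wprod ws (1 / (real k + x)) powr s" 
      if "ws \<in> twords M n" for ws
    proof -
      have "0 < wprod ws (1 / (real k + x))"
        using that z by (intro wprod_pos) (auto simp: twords_def)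
      then show ?thesis using z by (simp add: wprod_snoc powr_mult powr_divide powr_minus field_simps)
    qed
    then show "(\<Sum>ws\<in>twords M n. wprod (ws @ [k]) x powr s) = (real k + x) powr (-s) * pfun M s n (1 / (real k + x))"
      using z by (simp add: Suc.IH sum_distrib_left)
  qed
  finally show ?case ..
qed

section \<open>The full partition sum and its comparison with zeta\<close>

definition Zsum :: "nat \<Rightarrow> real \<Rightarrow> real" where
  "Zsum n s = (\<Sum>\<^sub>\<infinity>ws\<in>words n. exp (SUP x\<in>{0..1}. ln (\<Prod>j<n. cfrac_tail (drop j ws) x powr s)))"

lemma summable_zeta: "1 < s \<Longrightarrow> summable (\<lambda>n. real (Suc n) powr (-s))"
  using summable_real_powr_iff[of "-s"] summable_Suc_iff[of "\<lambda>n. real n powr (-s)"] by simp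

lemma sum_from_1: "(\<Sum>k=1..M. f k) = (\<Sum>n<M. f (Suc n))"
  by (rule sum.reindex_bij_witness[of _ Suc "\<lambda>k. k - 1"]) auto

lemma sum_powr_le_zeta: "1 < s \<Longrightarrow> (\<Sum>k=1..M. real k powr (-s)) \<le> zeta s"
  unfolding zeta_def sum_from_1 by (intro sum_le_suminf summable_zeta) auto

lemma sum_powr_tendsto_zeta: "1 < s \<Longrightarrow> (\<lambda>M. \<Sum>k=1..M. real k powr (-s)) \<longlonglongrightarrow> zeta s"
  unfolding zeta_def sum_from_1 by (intro summable_LIMSEQ summable_zeta)

lemma zeta_ge_one: "1 < s \<Longrightarrow> 1 \<le> zeta s"
  using one_le_sum_powr[of 1 s] sum_powr_le_zeta[of s 1] by simp

lemma pfun_le_power: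
  assumes "0 \<le> s" shows "pfun M s n 0 \<le> (\<Sum>k=1..M. real k powr (-s)) ^ n"
proof (induction n)
  case (Suc n)
  have "pfun M s (Suc n) 0 \<le> (\<Sum>k=1..M. real k powr (-s)) * pfun M s n 0"
    using trunc_op_le[OF pfun_cone[OF assms] order_refl] by simp
  also have "\<dots> \<le> (\<Sum>k=1..M. real k powr (-s)) * (\<Sum>k=1..M. real k powr (-s)) ^ n"
    using Suc.IH by (intro mult_left_mono sum_nonneg) auto
  finally show ?case by simp
qed auto

text \<open>Replacing \<open>F (1 / k)\<close> by \<open>2 powr (-s) * F 0\<close> costs one factor
  \<open>2 powr (-s)\<close> per application; with \<open>s = 2 * (t - q)\<close> this becomes the
  term with \<open>ln 4\<close> in the theorem.\<close>

lemma pfun_ge_power: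
  assumes "0 \<le> s" shows "(2 powr (-s) * (\<Sum>k=1..M. real k powr (-s))) ^ n \<le> pfun M s n 0"
proof (induction n)
  case (Suc n)
  have c: "pfun M s n \<in> decay_cone s" by (rule pfun_cone[OF assms])
  have "(2 powr (-s) * (\<Sum>k=1..M. real k powr (-s))) * (2 powr (-s) * (\<Sum>k=1..M. real k powr (-s))) ^ n
      \<le> (2 powr (-s) * (\<Sum>k=1..M. real k powr (-s))) * pfun M s n 0"
    using Suc.IH by (intro mult_left_mono mult_nonneg_nonneg sum_nonneg) auto
  also have "\<dots> = (\<Sum>k=1..M. real k powr (-s) * (2 powr (-s) * pfun M s n 0))"
    by (simp add: sum_distrib_left sum_distrib_right mult_ac)
  also have "\<dots> \<le> pfun M s (Suc n) 0"
    unfolding pfun.simps trunc_op_def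
    by (intro sum_mono) (auto intro!: mult_left_mono cone_lower[OF c] assms)
  finally show ?case by simp
qed auto

text \<open>The iterate \<open>pfun M s m\<close> is largest at 0; applying the positive operator
  \<open>n\<close> more times preserves the comparison with that constant.\<close>

lemma pfun_submult:
  assumes s: "0 \<le> s" and "0 \<le> x" "x \<le> 1"
  shows "pfun M s (n + m) x \<le> pfun M s m 0 * pfun M s n x"
  using assms(2,3)
proof (induction n arbitrary: x)
  case 0
  then show ?case using cone_antimono[OF pfun_cone[OF s]] by simp
next
  case (Suc n)
  have "pfun M s (Suc n + m) x \<le> (\<Sum>k=1..M. (real k + x) powr (-s) * (pfun M s m 0 * pfun M s n (1 / (real k + x))))"
    unfolding add_Suc pfun.simps trunc_op_def using Suc.prems
    by (intro sum_mono mult_left_mono Suc.IH) auto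
  also have "\<dots> = pfun M s m 0 * pfun M s (Suc n) x"
    by (simp add: trunc_op_def sum_distrib_left mult_ac)
  finally show ?case .
qed

text \<open>The sets \<open>twords M n\<close> exhaust \<open>words n\<close> along the filter of
  finite subsets, and the bound \<open>zeta s ^ n\<close> makes the family summable. All estimates
  uniform in \<open>M\<close> thereby pass to the infinite alphabet.\<close>

lemma pfun_tendsto_Zsum:
  assumes s: "1 < s" shows "(\<lambda>M. pfun M s n 0) \<longlonglongrightarrow> Zsum n s"
proof -
  define h where "h ws = wprod ws 0 powr s" for ws
  have Z: "Zsum n s = infsum h (words n)"
    unfolding Zsum_def h_def using s by (intro infsum_cong exp_sup_ln_wprod) auto
  have p: "pfun M s n 0 = sum h (twords M n)" for M
    using pfun_eq_sum_twords[of 0 M s n] by (simp add: h_def)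
  have ex: "\<exists>M0. \<forall>M\<ge>M0. X \<subseteq> twords M n" if X: "finite X" "X \<subseteq> words n" for X
  proof -
    have fin: "finite (\<Union>ws\<in>X. set ws)" using X by auto
    have "X \<subseteq> twords M n" if "M \<ge> Max (insert 0 (\<Union>ws\<in>X. set ws))" for M
    proof
      fix ws assume ws: "ws \<in> X"
      have "w \<le> M" if "w \<in> set ws" for w
      proof -
        have "w \<le> Max (insert 0 (\<Union>ws\<in>X. set ws))" using fin ws that by (intro Max_ge) auto
        with \<open>M \<ge> _\<close> show ?thesis by simp
      qed
      then show "ws \<in> twords M n" using X ws by (auto simp: twords_def words_def)
    qed
    then show ?thesis by blast
  qed
  have sub: "twords M n \<subseteq> words n" for M by (auto simp: twords_def words_def)
  have "h summable_on words n"
  proof (rule nonneg_bdd_above_summable_on)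
    show "bdd_above (sum h ` {F. F \<subseteq> words n \<and> finite F})"
    proof (rule bdd_aboveI2)
      fix F assume "F \<in> {F. F \<subseteq> words n \<and> finite F}"
      then obtain M where M: "F \<subseteq> twords M n" using ex[of F] by auto
      have "sum h F \<le> sum h (twords M n)" using M by (intro sum_mono2) (auto simp: h_def)
      also have "\<dots> \<le> (\<Sum>k=1..M. real k powr (-s)) ^ n" unfolding p[symmetric] using s by (intro pfun_le_power) auto
      also have "\<dots> \<le> zeta s ^ n" using s by (intro power_mono sum_powr_le_zeta sum_nonneg) auto
      finally show "sum h F \<le> zeta s ^ n" .
    qed
  qed (simp add: h_def)
  then have "(h has_sum Zsum n s) (words n)" unfolding Z by (rule has_sum_infsum)
  then have "(sum h \<longlongrightarrow> Zsum n s) (finite_subsets_at_top (words n))" by (simp add: has_sum_def)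
  moreover have "filterlim (\<lambda>M. twords M n) (finite_subsets_at_top (words n)) sequentially"
  proof (rule filterlim_finite_subsets_at_top[THEN iffD2], intro allI impI)
    fix X assume "finite X \<and> X \<subseteq> words n"
    then obtain M0 where "\<forall>M\<ge>M0. X \<subseteq> twords M n" using ex[of X] by auto
    then show "\<forall>\<^sub>F M in sequentially. finite (twords M n) \<and> X \<subseteq> twords M n \<and> twords M n \<subseteq> words n"
      using sub by (auto simp: eventually_sequentially)
  qed
  ultimately show ?thesis unfolding p by (rule filterlim_compose)
qed

lemma Zsum_upper: assumes "1 < s" shows "Zsum n s \<le> zeta s ^ n"
proof (rule LIMSEQ_le_const2[OF pfun_tendsto_Zsum[OF assms]], intro exI allI impI)
  fix M
  have "pfun M s n 0 \<le> (\<Sum>k=1..M. real k powr (-s)) ^ n" using assms by (intro pfun_le_power) auto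
  also have "\<dots> \<le> zeta s ^ n" using assms by (intro power_mono sum_powr_le_zeta sum_nonneg) auto
  finally show "pfun M s n 0 \<le> zeta s ^ n" .
qed

lemma Zsum_lower: assumes "1 < s" shows "(2 powr (-s) * zeta s) ^ n \<le> Zsum n s"
proof (rule LIMSEQ_le[OF _ pfun_tendsto_Zsum[OF assms]])
  show "(\<lambda>M. (2 powr (-s) * (\<Sum>k=1..M. real k powr (-s))) ^ n) \<longlonglongrightarrow> (2 powr (-s) * zeta s) ^ n"
    by (intro tendsto_intros sum_powr_tendsto_zeta assms)
qed (use pfun_ge_power assms in auto)

lemma Zsum_pos: assumes "1 < s" shows "0 < Zsum n s"
  using zeta_ge_one[OF assms] by (intro less_le_trans[OF _ Zsum_lower[OF assms]]) auto

lemma Zsum_submult: assumes "1 < s" shows "Zsum (n + m) s \<le> Zsum n s * Zsum m s"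
proof (rule LIMSEQ_le[OF pfun_tendsto_Zsum[OF assms]])
  show "(\<lambda>M. pfun M s n 0 * pfun M s m 0) \<longlonglongrightarrow> Zsum n s * Zsum m s"
    by (intro tendsto_intros pfun_tendsto_Zsum assms)
  show "\<exists>N. \<forall>M\<ge>N. pfun M s (n + m) 0 \<le> pfun M s n 0 * pfun M s m 0"
    using pfun_submult[of s 0 _ n m] assms by (simp add: mult.commute[of "pfun _ s m 0"])
qed

section \<open>Existence of the pressure\<close>

text \<open>Fekete's subadditive lemma. The linear lower bound makes the infimum of
  \<open>a n / n\<close> finite, and that infimum is the limit.\<close>

lemma fekete:
  fixes a :: "nat \<Rightarrow> real"
  assumes sub: "\<And>m n. a (m + n) \<le> a m + a n" and low: "\<And>n. c * real n \<le> a n"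
  shows "convergent (\<lambda>n. a n / real n)"
proof -
  define l where "l = (INF n\<in>{1..}. a n / real n)"
  have bdd: "bdd_below ((\<lambda>n. a n / real n) ` {1..})"
    using low by (intro bdd_belowI2[of _ c]) (auto simp: le_divide_eq)
  have ge: "l \<le> a n / real n" if "1 \<le> n" for n
    unfolding l_def using that bdd by (intro cINF_lower) auto
  have mult: "a (q * m + r) \<le> real q * a m + a r" for q m r
  proof (induction q)
    case (Suc q)
    have "a (Suc q * m + r) \<le> a m + a (q * m + r)" using sub[of m "q * m + r"] by (simp add: add.assoc)
    then show ?case using Suc.IH by (simp add: algebra_simps)
  qed auto
  have "(\<lambda>n. a n / real n) \<longlonglongrightarrow> l"
  proof (rule order_tendstoI)
    fix y assume "y < l"
    then have "\<forall>n\<ge>1. y < a n / real n" using ge by force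
    then show "\<forall>\<^sub>F n in sequentially. y < a n / real n" by (auto simp: eventually_sequentially)
  next
    fix y assume "l < y"
    then obtain m where m: "1 \<le> m" "a m / real m < y"
      unfolding l_def using cINF_less_iff[OF _ bdd] by auto
    \<comment> \<open>Division of \<open>n\<close> by a nearly optimal \<open>m\<close> leaves a
      remainder below \<open>m\<close>; \<open>C\<close> bounds the contribution of all remainders,
      so its share \<open>C / n\<close> vanishes.\<close>
    define b where "b = a m / real m"
    define C where "C = (MAX r\<in>{..<m}. a r - real r * b)"
    have le: "a n / real n \<le> b + C / real n" if "1 \<le> n" for n
    proof -
      have "a n \<le> real (n div m) * a m + a (n mod m)" using mult[of "n div m" m "n mod m"] by simp
      also have "real (n div m) * a m = (real (n div m) * real m) * b" using m by (simp add: b_def)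
      also have "real (n div m) * real m = real n - real (n mod m)"
        by (metis add_diff_cancel_right' div_mult_mod_eq of_nat_add of_nat_mult)
      also have "(real n - real (n mod m)) * b + a (n mod m) = real n * b + (a (n mod m) - real (n mod m) * b)"
        by (simp add: algebra_simps)
      also have "a (n mod m) - real (n mod m) * b \<le> C"
        unfolding C_def using m by (intro Max_ge) auto
      finally show ?thesis using that by (simp add: field_simps)
    qed
    have "(\<lambda>n. b + C / real n) \<longlonglongrightarrow> b + 0" by (intro tendsto_intros lim_const_over_n)
    then have "\<forall>\<^sub>F n in sequentially. b + C / real n < y" using m by (intro order_tendstoD) (auto simp: b_def)
    then show "\<forall>\<^sub>F n in sequentially. a n / real n < y"
      using eventually_ge_at_top[of 1] by eventually_elim (use le in force)
  qed
  then show ?thesis by (rule convergentI)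
qed

definition pressure :: "real \<Rightarrow> real" where
  "pressure s = lim (\<lambda>n. 1 / real n * ln (Zsum n s))"

lemma P1_eq_pressure: "P1 t q = pressure (2 * (t - q))"
  by (simp add: P1_def pressure_def partition_sum_def Zsum_def)

text \<open>The \<open>lim\<close> in \<open>pressure\<close> is informative only once convergence
  is known. Submultiplicativity of \<open>Zsum\<close> supplies subadditivity, the lower bound by
  zeta the linear minorant.\<close>

lemma pressure_LIMSEQ:
  assumes s: "1 < s" shows "(\<lambda>n. ln (Zsum n s) / real n) \<longlonglongrightarrow> pressure s"
proof -
  have "convergent (\<lambda>n. ln (Zsum n s) / real n)"
  proof (rule fekete[where c = "ln (2 powr (-s) * zeta s)"])
    fix m n
    have "ln (Zsum (m + n) s) \<le> ln (Zsum m s * Zsum n s)"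
      using Zsum_submult Zsum_pos s by (intro ln_mono) auto
    then show "ln (Zsum (m + n) s) \<le> ln (Zsum m s) + ln (Zsum n s)"
      using ln_mult_pos[OF Zsum_pos[OF s] Zsum_pos[OF s], of m n] by simp
    have pos: "0 < 2 powr (-s) * zeta s" using zeta_ge_one[OF s] by simp
    then have "ln ((2 powr (-s) * zeta s) ^ n) \<le> ln (Zsum n s)"
      using Zsum_lower Zsum_pos s by (intro ln_mono) auto
    then show "ln (2 powr (-s) * zeta s) * real n \<le> ln (Zsum n s)"
      unfolding ln_realpow by (simp only: mult.commute)
  qed
  then show ?thesis by (simp add: pressure_def convergent_LIMSEQ_iff)
qed

lemma pressure_upper: assumes s: "1 < s" shows "pressure s \<le> ln (zeta s)"
proof (rule LIMSEQ_le_const2[OF pressure_LIMSEQ[OF s]], intro exI[of _ 1] allI impI)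
  fix n :: nat assume n: "1 \<le> n"
  have "ln (Zsum n s) \<le> ln (zeta s ^ n)" using Zsum_upper Zsum_pos s by (intro ln_mono) auto
  then show "ln (Zsum n s) / real n \<le> ln (zeta s)"
    using n zeta_ge_one[OF s] by (simp add: ln_realpow field_simps)
qed

lemma pressure_lower: assumes s: "1 < s" shows "- s * ln 2 + ln (zeta s) \<le> pressure s"
proof (rule LIMSEQ_le_const[OF pressure_LIMSEQ[OF s]], intro exI[of _ 1] allI impI)
  fix n :: nat assume n: "1 \<le> n"
  have pos: "0 < 2 powr (-s) * zeta s" using zeta_ge_one[OF s] by simp
  then have "ln ((2 powr (-s) * zeta s) ^ n) \<le> ln (Zsum n s)"
    using Zsum_lower Zsum_pos s by (intro ln_mono) auto
  then have "ln (2 powr (-s) * zeta s) \<le> ln (Zsum n s) / real n"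
    using n unfolding ln_realpow by (subst pos_le_divide_eq) (simp_all only: mult.commute of_nat_0_less_iff)
  then show "- s * ln 2 + ln (zeta s) \<le> ln (Zsum n s) / real n"
    using zeta_ge_one[OF s] by (simp add: ln_mult ln_powr)
qed

section \<open>Differentiability and asymptotics of the pressure\<close>


lemma convex_on_limit:
  fixes f :: "nat \<Rightarrow> real \<Rightarrow> real"
  assumes conv: "\<forall>\<^sub>F n in sequentially. convex_on S (f n)"
    and lim: "\<And>x. x \<in> S \<Longrightarrow> (\<lambda>n. f n x) \<longlonglongrightarrow> g x" and S: "convex S"
  shows "convex_on S g"
proof (rule convex_onI)
  fix t x y assume t: "0 < t" "t < (1::real)" and xy: "x \<in> S" "y \<in> S"
  have z: "(1 - t) *\<^sub>R x + t *\<^sub>R y \<in> S" using S xy t by (intro convexD) auto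
  show "g ((1 - t) *\<^sub>R x + t *\<^sub>R y) \<le> (1 - t) * g x + t * g y"
  proof (rule tendsto_le[OF sequentially_bot])
    show "(\<lambda>n. (1 - t) * f n x + t * f n y) \<longlonglongrightarrow> (1 - t) * g x + t * g y"
      by (intro tendsto_intros lim xy)
    show "(\<lambda>n. f n ((1 - t) *\<^sub>R x + t *\<^sub>R y)) \<longlonglongrightarrow> g ((1 - t) *\<^sub>R x + t *\<^sub>R y)" by (rule lim[OF z])
    show "\<forall>\<^sub>F n in sequentially. f n ((1 - t) *\<^sub>R x + t *\<^sub>R y) \<le> (1 - t) * f n x + t * f n y"
      using conv by eventually_elim (use t xy in \<open>intro convex_onD[where A = S], auto\<close>)
  qed
qed (use S in auto)

lemma ln_pfun_derivs:
  assumes "1 \<le> M"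
  shows "((\<lambda>s. ln (pfun M s n 0)) has_real_derivative - (pfun1 M s n 0 / pfun M s n 0)) (at s)"
    and "((\<lambda>s. - (pfun1 M s n 0 / pfun M s n 0)) has_real_derivative
      (pfun2 M s n 0 - (pfun1 M s n 0)\<^sup>2 / pfun M s n 0) / pfun M s n 0) (at s)"
proof -
  have p: "0 < pfun M s n 0" for s using pfun_pos[OF assms, of 0] by simp
  show "((\<lambda>s. ln (pfun M s n 0)) has_real_derivative - (pfun1 M s n 0 / pfun M s n 0)) (at s)"
    using p[of s] by (auto intro!: derivative_eq_intros has_derivative_pfun)
  show "((\<lambda>s. - (pfun1 M s n 0 / pfun M s n 0)) has_real_derivative
      (pfun2 M s n 0 - (pfun1 M s n 0)\<^sup>2 / pfun M s n 0) / pfun M s n 0) (at s)"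
    using p[of s] by (auto intro!: derivative_eq_intros has_derivative_pfun has_derivative_pfun1
      simp: power2_eq_square field_simps)
qed

lemma ln_pfun_tendsto:
  assumes "1 < s" shows "(\<lambda>M. ln (pfun M s n 0)) \<longlonglongrightarrow> ln (Zsum n s)"
  using Zsum_pos[OF assms, of n] by (intro tendsto_ln pfun_tendsto_Zsum assms) auto

text \<open>Convexity comes from \<open>pfun_logconvex\<close> and survives two pointwise limits,
  first \<open>M\<close> and then \<open>n\<close>.\<close>

lemma convex_pressure: "convex_on {1<..} pressure"
proof (rule convex_on_limit)
  have "convex_on UNIV (\<lambda>s. ln (pfun M s n 0))" if "1 \<le> M" for M n
  proof (rule f''_ge0_imp_convex[OF _ ln_pfun_derivs[OF that]])
    show "0 \<le> (pfun2 M s n 0 - (pfun1 M s n 0)\<^sup>2 / pfun M s n 0) / pfun M s n 0" for s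
      using pfun_logconvex[OF that, of 0] pfun_pos[OF that, of 0 s n] by (intro divide_nonneg_nonneg) auto
  qed auto
  then have "\<forall>\<^sub>F M in sequentially. convex_on {1<..} (\<lambda>s. ln (pfun M s n 0))" for n
    using convex_on_subset[of UNIV _ "{1<..}"] by (intro eventually_sequentiallyI[of 1]) auto
  then have "convex_on {1<..} (\<lambda>s. ln (Zsum n s))" for n
    by (rule convex_on_limit) (auto intro: ln_pfun_tendsto)
  then have "convex_on {1<..} (\<lambda>s. 1 / real n * ln (Zsum n s))" for n
    by (intro convex_on_cmul) auto
  then show "\<forall>\<^sub>F n in sequentially. convex_on {1<..} (\<lambda>s. ln (Zsum n s) / real n)" by simp
qed (auto intro: pressure_LIMSEQ)

text \<open>An exponent \<open>b\<close> midway between 1 and \<open>a\<close> absorbs the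
  logarithms.\<close>

lemma summable_ln_powr:
  assumes "1 < (a::real)"
  shows "summable (\<lambda>n. (ln (real (Suc n)) + 2) * real (Suc n) powr (-a))"
    and "summable (\<lambda>n. (ln (real (Suc n) + 1))\<^sup>2 * real (Suc n) powr (-a))"
proof -
  define b where "b = (1 + a) / 2"
  have b: "1 < b" "b < a" using assms by (auto simp: b_def)
  have s: "summable (\<lambda>n. norm (real (Suc n) powr (-b)))" using summable_zeta[OF b(1)] by simp
  have "(\<lambda>n. (ln (real n + 1) + 2) * (real n + 1) powr (-a)) \<in> O(\<lambda>n. (real n + 1) powr (-b))"
    using b by real_asymp
  then show "summable (\<lambda>n. (ln (real (Suc n)) + 2) * real (Suc n) powr (-a))"
    by (intro summable_comparison_test_bigo[OF s]) (simp add: add.commute)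
  have "(\<lambda>n. (ln (real n + 1 + 1))\<^sup>2 * (real n + 1) powr (-a)) \<in> O(\<lambda>n. (real n + 1) powr (-b))"
    using b by real_asymp
  then show "summable (\<lambda>n. (ln (real (Suc n) + 1))\<^sup>2 * real (Suc n) powr (-a))"
    by (intro summable_comparison_test_bigo[OF s]) (simp add: add_ac)
qed

text \<open>The second derivative of \<open>ln (pfun M s n 0)\<close> is at most
  \<open>n * K\<close>, so a parabola of curvature \<open>n * K\<close> compensates it. After
  division by \<open>n\<close> the curvature no longer depends on \<open>M\<close> or
  \<open>n\<close>, and the limits can be taken.\<close>

lemma pressure_semiconcave:
  assumes a: "1 < a"
  obtains K where "convex_on {a..b} (\<lambda>s. K * s\<^sup>2 - pressure s)"
proof -
  define Zb where "Zb = zeta a"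
  define Lb where "Lb = (\<Sum>n. (ln (real (Suc n)) + 2) * real (Suc n) powr (-a))"
  define Hb where "Hb = (\<Sum>n. (ln (real (Suc n) + 1))\<^sup>2 * real (Suc n) powr (-a))"
  \<comment> \<open>The series decrease in \<open>s\<close> and are bounded by their values at
    \<open>a\<close>; \<open>2 powr s\<close>, \<open>diam\<close> and \<open>osc_bound\<close>
    increase in \<open>s\<close> and are taken at \<open>b\<close>. Thus one \<open>K\<close> serves
    the whole interval.\<close>
  define K where "K = 2 * (osc_bound b Zb Lb)\<^sup>2 + 2 * (2 powr b)\<^sup>2 * Hb"
  have Zb: "(\<Sum>k=1..M. real k powr (-s)) \<le> Zb" if "a \<le> s" for M s
  proof -
    have "(\<Sum>k=1..M. real k powr (-s)) \<le> (\<Sum>k=1..M. real k powr (-a))"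
      using that by (intro sum_mono powr_mono) auto
    then show ?thesis using sum_powr_le_zeta[OF a, of M] by (simp add: Zb_def)
  qed
  have Lb: "(\<Sum>k=1..M. (ln (real k) + 2) * real k powr (-s)) \<le> Lb" if "a \<le> s" for M s
  proof -
    have "(\<Sum>k=1..M. (ln (real k) + 2) * real k powr (-s)) \<le> (\<Sum>k=1..M. (ln (real k) + 2) * real k powr (-a))"
      using that by (intro sum_mono mult_left_mono powr_mono) auto
    also have "\<dots> \<le> Lb" unfolding Lb_def sum_from_1 using summable_ln_powr(1)[OF a] by (intro sum_le_suminf) auto
    finally show ?thesis .
  qed
  have Hb: "(\<Sum>k=1..M. (ln (real k + 1))\<^sup>2 * real k powr (-s)) \<le> Hb" if "a \<le> s" for M s
  proof -
    have "(\<Sum>k=1..M. (ln (real k + 1))\<^sup>2 * real k powr (-s)) \<le> (\<Sum>k=1..M. (ln (real k + 1))\<^sup>2 * real k powr (-a))"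
      using that by (intro sum_mono mult_left_mono powr_mono) auto
    also have "\<dots> \<le> Hb" unfolding Hb_def sum_from_1 using summable_ln_powr(2)[OF a] by (intro sum_le_suminf) auto
    finally show ?thesis .
  qed
  have nn: "0 \<le> Zb" "0 \<le> Lb" "0 \<le> Hb" using Zb[of a 0] Lb[of a 0] Hb[of a 0] by auto
  have var: "pfun2 M s n 0 - (pfun1 M s n 0)\<^sup>2 / pfun M s n 0 \<le> real n * K * pfun M s n 0"
    if M: "2 \<le> M" and s: "s \<in> {a..b}" for M s n
  proof -
    have s': "a \<le> s" "s \<le> b" "1 \<le> s" using s a by auto
    have d: "diam s Zb \<le> diam b Zb" "0 \<le> diam s Zb"
      unfolding diam_def using s' nn by (auto intro!: mult_mono power_mono)
    have "osc_bound s Zb Lb \<le> osc_bound b Zb Lb" "0 \<le> osc_bound s Zb Lb"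
      unfolding osc_bound_def using s' nn d by (auto intro!: mult_mono power_mono)
    then have "2 * (osc_bound s Zb Lb)\<^sup>2 + 2 * (2 powr s)\<^sup>2 * Hb \<le> K"
      unfolding K_def using s' nn by (intro add_mono mult_mono power_mono) auto
    then have "real n * (2 * (osc_bound s Zb Lb)\<^sup>2 + 2 * (2 powr s)\<^sup>2 * Hb) * pfun M s n 0 \<le> real n * K * pfun M s n 0"
      using pfun_pos[of M 0 s n] M by (intro mult_right_mono mult_left_mono) auto
    then show ?thesis
      using pfun_variance[OF s'(3) M Zb Lb Hb refl, of 0 n] s' by auto
  qed
  have "convex_on {a..b} (\<lambda>s. real n * K / 2 * s\<^sup>2 - ln (pfun M s n 0))" if M: "2 \<le> M" for M n
  proof (rule f''_ge0_imp_convex)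
    fix s assume s: "s \<in> {a..b}"
    have M1: "1 \<le> M" using M by simp
    have p: "0 < pfun M s n 0" using pfun_pos[OF M1] by simp
    show "((\<lambda>s. real n * K / 2 * s\<^sup>2 - ln (pfun M s n 0)) has_real_derivative
        real n * K * s - (- (pfun1 M s n 0 / pfun M s n 0))) (at s)"
      by (intro DERIV_diff ln_pfun_derivs(1)[OF M1]) (auto intro!: derivative_eq_intros)
    show "((\<lambda>s. real n * K * s - (- (pfun1 M s n 0 / pfun M s n 0))) has_real_derivative
        real n * K - (pfun2 M s n 0 - (pfun1 M s n 0)\<^sup>2 / pfun M s n 0) / pfun M s n 0) (at s)"
      by (intro DERIV_diff ln_pfun_derivs(2)[OF M1]) (auto intro!: derivative_eq_intros)
    show "0 \<le> real n * K - (pfun2 M s n 0 - (pfun1 M s n 0)\<^sup>2 / pfun M s n 0) / pfun M s n 0"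
      using var[OF M s, of n] p by (simp add: pos_divide_le_eq)
  qed auto
  then have "\<forall>\<^sub>F M in sequentially. convex_on {a..b} (\<lambda>s. real n * K / 2 * s\<^sup>2 - ln (pfun M s n 0))" for n
    by (intro eventually_sequentiallyI[of 2]) auto
  then have "convex_on {a..b} (\<lambda>s. real n * K / 2 * s\<^sup>2 - ln (Zsum n s))" for n
    by (rule convex_on_limit) (use a in \<open>auto intro!: tendsto_diff tendsto_const ln_pfun_tendsto\<close>)
  then have "convex_on {a..b} (\<lambda>s. 1 / real n * (real n * K / 2 * s\<^sup>2 - ln (Zsum n s)))" for n
    by (intro convex_on_cmul) auto
  moreover have "(\<lambda>n. 1 / real n * (real n * K / 2 * s\<^sup>2 - ln (Zsum n s))) \<longlonglongrightarrow> K / 2 * s\<^sup>2 - pressure s"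
    if "s \<in> {a..b}" for s
  proof -
    have "(\<lambda>n. K / 2 * s\<^sup>2 - ln (Zsum n s) / real n) \<longlonglongrightarrow> K / 2 * s\<^sup>2 - pressure s"
      using that a by (intro tendsto_intros pressure_LIMSEQ) auto
    then show ?thesis
      by (rule Lim_transform_eventually) (auto intro!: eventually_sequentiallyI[of 1] simp: field_simps)
  qed
  ultimately have "convex_on {a..b} (\<lambda>s. K / 2 * s\<^sup>2 - pressure s)"
    by (intro convex_on_limit[where f = "\<lambda>n s. 1 / real n * (real n * K / 2 * s\<^sup>2 - ln (Zsum n s))"]) auto
  then show ?thesis by (rule that)
qed

text \<open>A convex function that is also semiconcave is squeezed between a supporting line and that
  line plus a quadratic.\<close>

lemma convex_semiconcave_differentiable:
  fixes p :: "real \<Rightarrow> real"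
  assumes p: "convex_on I p" "a \<le> x - e" "x + e \<le> b" "0 < e" "{a..b} \<subseteq> I"
    and q: "convex_on {a..b} (\<lambda>s. K * s\<^sup>2 - p s)"
  obtains m where "(p has_real_derivative m) (at x)" "\<And>y. y \<in> I \<Longrightarrow> p x + m * (y - x) \<le> p y"
proof -
  have "x \<in> interior I"
    using p by (intro interiorI[of "{x-e<..<x+e}"]) (auto simp: subset_iff)
  \<comment> \<open>The infimum of the difference quotients to the right of \<open>x\<close>, which
    is the slope of a supporting line.\<close>
  define m where "m = Inf ((\<lambda>t. (p x - p t) / (x - t)) ` ({x<..} \<inter> I))"
  have above: "p x + m * (y - x) \<le> p y" if "y \<in> I" for y
    unfolding m_def by (rule convex_le_Inf_differential[OF p(1) \<open>x \<in> interior I\<close> that])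
  \<comment> \<open>Midpoint convexity at \<open>x - h\<close> and \<open>x + h\<close> bounds the
    second difference of \<open>p\<close>; the supporting line at \<open>x - h\<close> then leaves
    an upper bound at \<open>x + h\<close>.\<close>
  have upper: "p (x + h) - p x - m * h \<le> 2 * K * h\<^sup>2" if h: "\<bar>h\<bar> < e" for h
  proof -
    have "(1 - 1/2) *\<^sub>R (x - h) + (1/2) *\<^sub>R (x + h) = x" by (simp add: field_simps)
    moreover have "(\<lambda>s. K * s\<^sup>2 - p s) ((1 - 1/2) *\<^sub>R (x - h) + (1/2) *\<^sub>R (x + h))
        \<le> (1 - 1/2) * (K * (x - h)\<^sup>2 - p (x - h)) + 1/2 * (K * (x + h)\<^sup>2 - p (x + h))"
      using h p by (intro convex_onD[OF q]) auto
    ultimately have "K * x\<^sup>2 - p x \<le> 1/2 * (K * (x - h)\<^sup>2 - p (x - h)) + 1/2 * (K * (x + h)\<^sup>2 - p (x + h))"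
      by simp
    also have "\<dots> = K * x\<^sup>2 + K * h\<^sup>2 - (p (x - h) + p (x + h)) / 2"
      by (simp add: power2_sum power2_diff field_simps)
    finally have "p (x + h) + p (x - h) - 2 * p x \<le> 2 * K * h\<^sup>2" by (simp add: field_simps)
    moreover have "x - h \<in> {a..b}" using h p by auto
    then have "p x + m * (- h) \<le> p (x - h)" using above[of "x - h"] p(5) by auto
    ultimately show ?thesis by (simp add: algebra_simps)
  qed
  have bound: "\<bar>(p (x + h) - p x) / h - m\<bar> \<le> 2 * \<bar>K\<bar> * \<bar>h\<bar>" if h: "\<bar>h\<bar> < e" "h \<noteq> 0" for h
  proof -
    have "x + h \<in> {a..b}" using h p by auto
    then have "0 \<le> p (x + h) - p x - m * h" using above[of "x + h"] p(5) by auto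
    moreover have "p (x + h) - p x - m * h \<le> 2 * \<bar>K\<bar> * \<bar>h\<bar> * \<bar>h\<bar>"
    proof -
      have "2 * K * h\<^sup>2 \<le> 2 * \<bar>K\<bar> * h\<^sup>2" by (intro mult_right_mono) auto
      then show ?thesis using upper[OF h(1)] by (simp add: power2_eq_square mult.assoc abs_mult_self_eq)
    qed
    ultimately have "\<bar>p (x + h) - p x - m * h\<bar> \<le> 2 * \<bar>K\<bar> * \<bar>h\<bar> * \<bar>h\<bar>" by linarith
    moreover have "(p (x + h) - p x) / h - m = (p (x + h) - p x - m * h) / h" using h by (simp add: field_simps)
    ultimately show ?thesis using h by (simp add: abs_divide field_simps)
  qed
  have "((\<lambda>h. (p (x + h) - p x) / h - m) \<longlongrightarrow> 0) (at 0)"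
  proof (rule Lim_null_comparison)
    have "\<forall>\<^sub>F h in at 0. \<bar>h\<bar> < e \<and> h \<noteq> 0"
      using p(4) by (auto simp: eventually_at dist_real_def)
    then show "\<forall>\<^sub>F h in at 0. norm ((p (x + h) - p x) / h - m) \<le> 2 * \<bar>K\<bar> * \<bar>h\<bar>"
      by eventually_elim (use bound in auto)
    show "((\<lambda>h. 2 * \<bar>K\<bar> * \<bar>h\<bar>) \<longlongrightarrow> 0) (at 0)" by (auto intro!: tendsto_eq_intros)
  qed
  then have "(p has_real_derivative m) (at x)"
    unfolding DERIV_def by (rule LIM_zero_cancel)
  with above show ?thesis using that by blast
qed

lemma pressure_derivative:
  assumes "1 < s"
  shows "(pressure has_real_derivative deriv pressure s) (at s)"
    and "1 < y \<Longrightarrow> pressure s + deriv pressure s * (y - s) \<le> pressure y"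
proof -
  define e where "e = (s - 1) / 2"
  obtain K where "convex_on {s - e..s + e} (\<lambda>s. K * s\<^sup>2 - pressure s)"
    using pressure_semiconcave[of "s - e" "s + e"] assms by (auto simp: e_def field_simps)
  then obtain m where m: "(pressure has_real_derivative m) (at s)"
    "\<And>y. y \<in> {1<..} \<Longrightarrow> pressure s + m * (y - s) \<le> pressure y"
    by (rule convex_semiconcave_differentiable[OF convex_pressure order_refl order_refl, rotated 2])
      (use assms in \<open>auto simp: e_def field_simps\<close>)
  have "deriv pressure s = m" using m(1) by (rule DERIV_imp_deriv)
  with m show "(pressure has_real_derivative deriv pressure s) (at s)"
    "1 < y \<Longrightarrow> pressure s + deriv pressure s * (y - s) \<le> pressure y" by auto
qed

section \<open>The golden mean and the behaviour at infinity\<close>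

definition golden :: real where "golden = (1 + sqrt 5) / 2"

lemma golden: "1 < golden" "golden * golden = golden + 1"
proof -
  have "1 < sqrt (5::real)" by simp
  then show "1 < golden" by (simp add: golden_def)
  show "golden * golden = golden + 1" by (simp add: golden_def field_simps)
qed

text \<open>The function \<open>1 / (x + golden)\<close> is an eigenfunction, with eigenvalue \<open>1 / golden\<close>, of the
  branch \<open>k = 1\<close> at exponent 1, and this branch is the largest one.\<close>

lemma pfun_golden_lower:
  assumes M: "1 \<le> M" and s: "0 \<le> s" and "0 \<le> x"
  shows "(golden ^ n * (x + golden)) powr (-s) \<le> pfun M s n x"
  using assms(3)
proof (induction n arbitrary: x)
  case 0
  have "(x + golden) powr (-s) \<le> (x + golden) powr 0"
    using golden 0 s by (intro powr_mono) auto
  then show ?case using golden 0 by simp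
next
  case (Suc n)
  have g: "0 < golden" using golden by simp
  have "golden * (x + golden) = (1 + x) * (1 / (1 + x) + golden)"
    using Suc.prems golden(2) by (simp add: field_simps)
  then have "golden ^ Suc n * (x + golden) = (1 + x) * (golden ^ n * (1 / (1 + x) + golden))"
    by simp
  then have "(golden ^ Suc n * (x + golden)) powr (-s) = (1 + x) powr (-s) * (golden ^ n * (1 / (1 + x) + golden)) powr (-s)"
    using Suc.prems g by (simp only: powr_mult)
  also have "\<dots> \<le> (1 + x) powr (-s) * pfun M s n (1 / (1 + x))"
    using Suc.prems by (intro mult_left_mono Suc.IH) auto
  also have "\<dots> \<le> pfun M s (Suc n) x"
    using member_le_sum[of 1 "{1..M}" "\<lambda>k. (real k + x) powr (-s) * pfun M s n (1 / (real k + x))"]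
      M Suc.prems less_imp_le[OF pfun_pos[OF M]] by (auto simp: trunc_op_def)
  finally show ?case .
qed

text \<open>Every branch has \<open>z = k + x \<ge> 1 + x\<close>, whence \<open>z * (1 / z +
  golden) = 1 + golden * z \<ge> golden * (x + golden)\<close>: each letter gains a factor
  \<open>golden\<close>. Only the increment \<open>d\<close> is estimated in this way, since the sum
  over the infinite alphabet needs a base exponent above 1. Division by \<open>1 + golden\<close>
  makes the case \<open>n = 0\<close> true on the unit interval.\<close>

lemma pfun_golden_upper:
  assumes M: "1 \<le> M" and d: "0 \<le> d" and "0 \<le> x" "x \<le> 1"
  shows "pfun M (s + d) n x \<le> (golden ^ n * (x + golden) / (1 + golden)) powr (-d) * pfun M s n x"
  using assms(3,4)
proof (induction n arbitrary: x)
  case 0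
  have "((x + golden) / (1 + golden)) powr 0 \<le> ((x + golden) / (1 + golden)) powr (-d)"
    using golden 0 d by (intro powr_mono') (auto simp: divide_simps)
  then show ?case using golden 0 by simp
next
  case (Suc n)
  have g: "0 < golden" using golden by simp
  have "(real k + x) powr (-(s + d)) * pfun M (s + d) n (1 / (real k + x))
      \<le> (golden ^ Suc n * (x + golden) / (1 + golden)) powr (-d) * ((real k + x) powr (-s) * pfun M s n (1 / (real k + x)))"
    if k: "k \<in> {1..M}" for k
  proof -
    define z where "z = real k + x"
    have z: "1 \<le> z" "1 + x \<le> z" using k Suc.prems by (auto simp: z_def)
    have "pfun M (s + d) n (1 / z) \<le> (golden ^ n * (1 / z + golden) / (1 + golden)) powr (-d) * pfun M s n (1 / z)"
      using z by (intro Suc.IH) auto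
    then have "z powr (-(s + d)) * pfun M (s + d) n (1 / z)
        \<le> z powr (-(s + d)) * ((golden ^ n * (1 / z + golden) / (1 + golden)) powr (-d) * pfun M s n (1 / z))"
      by (intro mult_left_mono) auto
    also have "\<dots> = (z powr (-d) * (golden ^ n * (1 / z + golden) / (1 + golden)) powr (-d)) * (z powr (-s) * pfun M s n (1 / z))"
      using z by (simp add: powr_diff powr_minus powr_add field_simps)
    also have "z powr (-d) * (golden ^ n * (1 / z + golden) / (1 + golden)) powr (-d)
        = (golden ^ n * (1 + golden * z) / (1 + golden)) powr (-d)"
    proof -
      have "1 + golden * z = z * (1 / z + golden)" using z by (simp add: field_simps)
      then have "golden ^ n * (1 + golden * z) / (1 + golden) = z * (golden ^ n * (1 / z + golden) / (1 + golden))"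
        by simp
      then show ?thesis using z g by (simp only: powr_mult)
    qed
    also have "\<dots> \<le> (golden ^ Suc n * (x + golden) / (1 + golden)) powr (-d)"
    proof (rule powr_mono2')
      have "golden * (x + golden) \<le> 1 + golden * z"
        using golden mult_left_mono[OF z(2), of golden] by (simp add: algebra_simps)
      then show "golden ^ Suc n * (x + golden) / (1 + golden) \<le> golden ^ n * (1 + golden * z) / (1 + golden)"
        using g mult_left_mono[of "golden * (x + golden)" "1 + golden * z" "golden ^ n"]
        by (intro divide_right_mono) (auto simp: mult_ac)
    qed (use d g Suc.prems in auto)
    finally show ?thesis
      using less_imp_le[OF pfun_pos[OF M, of "1 / z" s n]] z by (simp add: z_def mult_right_mono)
  qed
  then have "pfun M (s + d) (Suc n) x \<le> (\<Sum>k=1..M. (golden ^ Suc n * (x + golden) / (1 + golden)) powr (-d) * ((real k + x) powr (-s) * pfun M s n (1 / (real k + x))))"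
    unfolding pfun.simps trunc_op_def by (intro sum_mono) auto
  then show ?case by (simp only: pfun.simps trunc_op_def sum_distrib_left)
qed

lemma pressure_golden_lower:
  assumes s: "1 < s" shows "- s * ln golden \<le> pressure s"
proof (rule LIMSEQ_le[OF _ pressure_LIMSEQ[OF s]])
  show "(\<lambda>n. (- s * ln golden) * ((real n + 1) / real n)) \<longlonglongrightarrow> - s * ln golden"
  proof -
    have "(\<lambda>n. (real n + 1) / real n) \<longlonglongrightarrow> 1" by real_asymp
    from tendsto_mult[OF tendsto_const this, of "- s * ln golden"] show ?thesis by simp
  qed
  show "\<exists>N. \<forall>n\<ge>N. (- s * ln golden) * ((real n + 1) / real n) \<le> ln (Zsum n s) / real n"
  proof (intro exI[of _ 1] allI impI)
    fix n :: nat assume n: "1 \<le> n"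
    have g: "0 < golden" using golden by simp
    have "(golden ^ Suc n) powr (-s) \<le> Zsum n s"
      using pfun_golden_lower[of _ s 0 n] s
      by (intro LIMSEQ_le_const[OF pfun_tendsto_Zsum[OF s]]) (auto intro!: exI[of _ 1] simp: mult.commute)
    then have "ln ((golden ^ Suc n) powr (-s)) \<le> ln (Zsum n s)"
      using g Zsum_pos[OF s] by (intro ln_mono) auto
    also have "ln ((golden ^ Suc n) powr (-s)) = - s * (real n + 1) * ln golden"
      using g by (simp only: ln_powr ln_realpow) (simp add: algebra_simps)
    finally have "- s * (real n + 1) * ln golden / real n \<le> ln (Zsum n s) / real n"
      by (rule divide_right_mono) simp
    then show "(- s * ln golden) * ((real n + 1) / real n) \<le> ln (Zsum n s) / real n"
      by (simp add: mult_ac)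
  qed
qed

lemma pressure_golden_upper:
  assumes s: "1 < s" and d: "0 \<le> d" shows "pressure (s + d) \<le> - d * ln golden + pressure s"
proof (rule LIMSEQ_le[OF pressure_LIMSEQ])
  \<comment> \<open>The contribution to \<open>ln c\<close> of the factor
    \<open>golden / (1 + golden)\<close>, which does not depend on \<open>n\<close>.\<close>
  define C where "C = d * (ln (1 + golden) - ln golden)"
  have g: "0 < golden" using golden by simp
  have "(\<lambda>n. C / real n - d * ln golden + ln (Zsum n s) / real n) \<longlonglongrightarrow> 0 - d * ln golden + pressure s"
    by (intro tendsto_intros lim_const_over_n pressure_LIMSEQ[OF s])
  then show "(\<lambda>n. C / real n - d * ln golden + ln (Zsum n s) / real n) \<longlonglongrightarrow> - d * ln golden + pressure s"
    by simp
  show "\<exists>N. \<forall>n\<ge>N. ln (Zsum n (s + d)) / real n \<le> C / real n - d * ln golden + ln (Zsum n s) / real n"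
  proof (intro exI[of _ 1] allI impI)
    fix n :: nat assume n: "1 \<le> n"
    define c where "c = (golden ^ n * golden / (1 + golden)) powr (-d)"
    have c: "0 < c" using g by (simp add: c_def)
    have "Zsum n (s + d) \<le> c * Zsum n s"
    proof (rule LIMSEQ_le[OF pfun_tendsto_Zsum])
      show "(\<lambda>M. c * pfun M s n 0) \<longlonglongrightarrow> c * Zsum n s" by (intro tendsto_intros pfun_tendsto_Zsum s)
      show "\<exists>N. \<forall>M\<ge>N. pfun M (s + d) n 0 \<le> c * pfun M s n 0"
        using pfun_golden_upper[of _ d 0 s n] d by (intro exI[of _ 1]) (simp add: c_def)
    qed (use s d in auto)
    then have "ln (Zsum n (s + d)) \<le> ln (c * Zsum n s)"
      using Zsum_pos[of "s + d" n] s d by (intro ln_mono) auto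
    also have "\<dots> = ln c + ln (Zsum n s)" using c Zsum_pos[OF s] by (intro ln_mult_pos) auto
    also have "ln c = C - d * ln golden * real n"
    proof -
      have "ln c = - d * (ln (golden ^ n * golden) - ln (1 + golden))"
        using g by (simp add: c_def ln_powr ln_div)
      also have "ln (golden ^ n * golden) = real n * ln golden + ln golden"
        using g by (simp add: ln_mult_pos ln_realpow)
      finally show ?thesis by (simp add: C_def algebra_simps)
    qed
    finally show "ln (Zsum n (s + d)) / real n \<le> C / real n - d * ln golden + ln (Zsum n s) / real n"
      using n by (simp add: field_simps)
  qed
qed (use s d in auto)

lemma pressure_over_tendsto: "((\<lambda>s. pressure s / s) \<longlongrightarrow> - ln golden) at_top"
proof (rule tendsto_sandwich)
  show "\<forall>\<^sub>F s in at_top. - ln golden \<le> pressure s / s"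
    using eventually_gt_at_top[of 1] by eventually_elim (use pressure_golden_lower in \<open>simp add: field_simps\<close>)
  show "\<forall>\<^sub>F s in at_top. pressure s / s \<le> (- (s - 2) * ln golden + pressure 2) / s"
    using eventually_gt_at_top[of 2]
  proof eventually_elim
    case (elim s)
    then show ?case using pressure_golden_upper[of 2 "s - 2"] by (intro divide_right_mono) auto
  qed
  show "((\<lambda>s. (- (s - 2) * ln golden + pressure 2) / s) \<longlongrightarrow> - ln golden) at_top"
    by real_asymp
qed auto

text \<open>The tangent at \<open>s\<close> lies below the pressure. Testing it at
  \<open>s / 2\<close> and at \<open>2 * s\<close> encloses the derivative between combinations of
  \<open>pressure s / s\<close> that both tend to \<open>2 * L - L = L\<close> with
  \<open>L = - ln golden\<close>.\<close>

lemma deriv_pressure_tendsto: "(deriv pressure \<longlongrightarrow> - ln golden) at_top"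
proof (rule tendsto_sandwich)
  have 2: "((\<lambda>s. pressure (2 * s) / (2 * s)) \<longlongrightarrow> - ln golden) at_top"
    by (rule filterlim_compose[OF pressure_over_tendsto]) real_asymp
  have h: "((\<lambda>s. pressure (s / 2) / (s / 2)) \<longlongrightarrow> - ln golden) at_top"
    by (rule filterlim_compose[OF pressure_over_tendsto]) real_asymp
  have "((\<lambda>s. 2 * (pressure s / s) - pressure (s / 2) / (s / 2)) \<longlongrightarrow> 2 * (- ln golden) - (- ln golden)) at_top"
    by (intro tendsto_intros h pressure_over_tendsto)
  then show "((\<lambda>s. 2 * (pressure s / s) - pressure (s / 2) / (s / 2)) \<longlongrightarrow> - ln golden) at_top" by simp
  have "((\<lambda>s. 2 * (pressure (2 * s) / (2 * s)) - pressure s / s) \<longlongrightarrow> 2 * (- ln golden) - (- ln golden)) at_top"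
    by (intro tendsto_intros 2 pressure_over_tendsto)
  then show "((\<lambda>s. 2 * (pressure (2 * s) / (2 * s)) - pressure s / s) \<longlongrightarrow> - ln golden) at_top" by simp
  show "\<forall>\<^sub>F s in at_top. 2 * (pressure s / s) - pressure (s / 2) / (s / 2) \<le> deriv pressure s"
    using eventually_gt_at_top[of 2]
  proof eventually_elim
    case (elim s)
    then show ?case using pressure_derivative(2)[of s "s / 2"] by (simp add: field_simps)
  qed
  show "\<forall>\<^sub>F s in at_top. deriv pressure s \<le> 2 * (pressure (2 * s) / (2 * s)) - pressure s / s"
    using eventually_gt_at_top[of 2]
  proof eventually_elim
    case (elim s)
    then show ?case using pressure_derivative(2)[of s "2 * s"] by (simp add: field_simps)
  qed
qed

section \<open>The behaviour at exponent 1 and the transfer to \<open>P1\<close>\<close>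

text \<open>A finite partial sum is continuous in \<open>s\<close> and equals a harmonic number at
  \<open>s = 1\<close>, which can be made arbitrarily large.\<close>

lemma ln_zeta_at_top: "filterlim (\<lambda>s. ln (zeta s)) at_top (at_right 1)"
proof (rule filterlim_compose[OF ln_at_top], unfold filterlim_at_top, intro allI)
  fix Z :: real
  have "filterlim (\<lambda>N. harm N :: real) at_top sequentially" by (rule harm_at_top)
  then obtain N where N: "Z + 1 \<le> harm N"
    by (auto simp: filterlim_at_top eventually_sequentially)
  have "((\<lambda>s. \<Sum>k=1..N. real k powr (-s)) \<longlongrightarrow> (\<Sum>k=1..N. real k powr (-1))) (at_right 1)"
    by (intro tendsto_intros) auto
  moreover have "(\<Sum>k=1..N. real k powr (-1)) = harm N"
    unfolding harm_def by (intro sum.cong) (auto simp: powr_minus)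
  ultimately have "\<forall>\<^sub>F s in at_right 1. Z < (\<Sum>k=1..N. real k powr (-s))"
    using N by (intro order_tendstoD(1)) auto
  then show "\<forall>\<^sub>F s in at_right 1. Z \<le> zeta s"
    using eventually_at_right_less[of 1]
  proof eventually_elim
    case (elim s)
    then show ?case using sum_powr_le_zeta[of s N] by linarith
  qed
qed

lemma pressure_at_top: "filterlim pressure at_top (at_right 1)"
proof (rule filterlim_at_top_mono)
  have "((\<lambda>s::real. - s * ln 2) \<longlongrightarrow> - 1 * ln 2) (at_right 1)" by (intro tendsto_intros)
  then show "filterlim (\<lambda>s. - s * ln 2 + ln (zeta s)) at_top (at_right 1)"
    by (rule filterlim_tendsto_add_at_top[OF _ ln_zeta_at_top])
  show "\<forall>\<^sub>F s in at_right 1. - s * ln 2 + ln (zeta s) \<le> pressure s"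
    using eventually_at_right_less[of 1] by eventually_elim (rule pressure_lower)
qed

text \<open>The tangent at \<open>s\<close>, tested at 2, gives
  \<open>pressure s - pressure 2 \<le> - deriv pressure s * (2 - s)\<close>. Near 1 the left side is
  nonnegative, so the derivative is at most 0 and the factor \<open>2 - s\<close>, which is below 1,
  can be replaced by 1.\<close>

lemma minus_deriv_pressure_at_top: "filterlim (\<lambda>s. - deriv pressure s) at_top (at_right 1)"
proof (rule filterlim_at_top_mono)
  show "filterlim (\<lambda>s. - pressure 2 + pressure s) at_top (at_right 1)"
    by (rule filterlim_tendsto_add_at_top[OF tendsto_const pressure_at_top])
  have "\<forall>\<^sub>F s in at_right 1. pressure 2 \<le> pressure s"
    using pressure_at_top by (simp add: filterlim_at_top)
  moreover have "\<forall>\<^sub>F s in at_right 1. s < (2::real)"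
    by (rule eventually_at_right_real[of 1 2, THEN eventually_mono]) auto
  ultimately show "\<forall>\<^sub>F s in at_right 1. - pressure 2 + pressure s \<le> - deriv pressure s"
    using eventually_at_right_less[of 1]
  proof eventually_elim
    case (elim s)
    have 1: "pressure s - pressure 2 \<le> (- deriv pressure s) * (2 - s)"
      using pressure_derivative(2)[OF elim(3), of 2] by simp
    then have "0 \<le> - deriv pressure s"
      using elim by (smt (verit) mult_neg_pos)
    then have "(- deriv pressure s) * (2 - s) \<le> (- deriv pressure s) * 1"
      using elim by (intro mult_left_mono) auto
    with 1 show ?case by simp
  qed
qed

lemma deriv_P1:
  assumes "1 < 2 * (t - q)" shows "deriv (P1 t) q = 2 * (- deriv pressure (2 * (t - q)))"
proof (rule DERIV_imp_deriv)
  have "((\<lambda>q. pressure (2 * (t - q))) has_real_derivative deriv pressure (2 * (t - q)) * (- 2)) (at q)"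
    by (rule DERIV_chain2[where f = pressure and g = "\<lambda>q. 2 * (t - q)", OF pressure_derivative(1)[OF assms]])
      (auto intro!: derivative_eq_intros)
  then show "(P1 t has_real_derivative 2 * (- deriv pressure (2 * (t - q)))) (at q)"
    by (simp add: P1_eq_pressure[abs_def] mult.commute)
qed

theorem proposition6p1:
  shows "(\<forall>(t, q) \<in> Dtilde.
           - (t - q) * ln 4 + ln (zeta (2 * t - 2 * q)) \<le> P1 t q \<and>
           P1 t q \<le> ln (zeta (2 * t - 2 * q))) \<and>
         (\<forall>t0 q0 :: real. t0 - q0 = 1/2 \<longrightarrow>
           filterlim (\<lambda>(t, q). P1 t q) at_top (at (t0, q0) within Dtilde)) \<and>
         (\<forall>t :: real. filterlim (\<lambda>q. deriv (P1 t) q) at_top (at_left (t - 1/2))) \<and>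
         (\<forall>t :: real. ((\<lambda>q. P1 t q / q) \<longlongrightarrow> gamma0) at_bot \<and>
           ((\<lambda>q. deriv (P1 t) q) \<longlongrightarrow> gamma0) at_bot)"
proof (intro conjI allI impI ballI)
  have ln4: "ln 4 = 2 * ln (2::real)"
    using ln_realpow[of "2::real" 2] by simp
  fix tq :: "real \<times> real" assume "tq \<in> Dtilde"
  then show "case tq of (t, q) \<Rightarrow> - (t - q) * ln 4 + ln (zeta (2 * t - 2 * q)) \<le> P1 t q \<and>
           P1 t q \<le> ln (zeta (2 * t - 2 * q))"
    using pressure_lower[of "2 * (fst tq - snd tq)"] pressure_upper[of "2 * (fst tq - snd tq)"]
    by (auto simp: Dtilde_def P1_eq_pressure ln4 algebra_simps)
next
  fix t0 q0 :: real assume 0: "t0 - q0 = 1/2"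
  \<comment> \<open>The restriction to \<open>Dtilde\<close> is exactly the approach of
    \<open>s = 2 * (t - q)\<close> to 1 from the right.\<close>
  have "filterlim (\<lambda>x. 2 * (fst x - snd x)) (at_right 1) (at (t0, q0) within Dtilde)"
    unfolding filterlim_at
  proof
    show "\<forall>\<^sub>F x in at (t0, q0) within Dtilde. 2 * (fst x - snd x) \<in> {1<..} \<and> 2 * (fst x - snd x) \<noteq> 1"
      by (auto simp: eventually_at_filter Dtilde_def intro!: always_eventually)
    have "((\<lambda>x. 2 * (fst x - snd x)) \<longlongrightarrow> 2 * (fst (t0, q0) - snd (t0, q0))) (at (t0, q0) within Dtilde)"
      by (intro tendsto_intros)
    then show "((\<lambda>x. 2 * (fst x - snd x)) \<longlongrightarrow> 1) (at (t0, q0) within Dtilde)" using 0 by simp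
  qed
  from filterlim_compose[OF pressure_at_top this]
  show "filterlim (\<lambda>(t, q). P1 t q) at_top (at (t0, q0) within Dtilde)"
    by (simp add: case_prod_unfold P1_eq_pressure)
next
  fix t :: real
  have "filterlim (\<lambda>q. 2 * (t - q)) (at_right 1) (at_left (t - 1/2))"
    unfolding filterlim_at
  proof
    show "\<forall>\<^sub>F q in at_left (t - 1/2). 2 * (t - q) \<in> {1<..} \<and> 2 * (t - q) \<noteq> 1"
      by (auto simp: eventually_at_filter intro!: always_eventually)
    have "((\<lambda>q. 2 * (t - q)) \<longlongrightarrow> 2 * (t - (t - 1/2))) (at_left (t - 1/2))" by (intro tendsto_intros)
    then show "((\<lambda>q. 2 * (t - q)) \<longlongrightarrow> 1) (at_left (t - 1/2))" by simp
  qed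
  from filterlim_compose[OF minus_deriv_pressure_at_top this]
  have "filterlim (\<lambda>q. 2 * (- deriv pressure (2 * (t - q)))) at_top (at_left (t - 1/2))"
    by (intro filterlim_tendsto_pos_mult_at_top[OF tendsto_const]) auto
  then show "filterlim (\<lambda>q. deriv (P1 t) q) at_top (at_left (t - 1/2))"
  proof (rule filterlim_at_top_mono)
    show "\<forall>\<^sub>F q in at_left (t - 1/2). 2 * (- deriv pressure (2 * (t - q))) \<le> deriv (P1 t) q"
      by (auto simp: eventually_at_filter deriv_P1 intro!: always_eventually)
  qed
next
  fix t :: real
  have lim: "filterlim (\<lambda>q. 2 * (t - q)) at_top at_bot" by real_asymp
  have g: "gamma0 = - ln golden * - 2" by (simp add: gamma0_def golden_def)
  \<comment> \<open>With \<open>s = 2 * (t - q)\<close>, the quotient \<open>P1 t q / q\<close>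
    factors into \<open>pressure s / s\<close>, which tends to \<open>- ln golden\<close>, and
    \<open>s / q\<close>, which tends to -2.\<close>
  have "((\<lambda>q. pressure (2 * (t - q)) / (2 * (t - q)) * (2 * (t - q) / q)) \<longlongrightarrow> - ln golden * - 2) at_bot"
  proof (rule tendsto_mult[OF filterlim_compose[OF pressure_over_tendsto lim]])
    show "((\<lambda>q. 2 * (t - q) / q) \<longlongrightarrow> - 2) at_bot" by real_asymp
  qed
  then show "((\<lambda>q. P1 t q / q) \<longlongrightarrow> gamma0) at_bot"
    unfolding g
  proof (rule Lim_transform_eventually)
    show "\<forall>\<^sub>F q in at_bot. pressure (2 * (t - q)) / (2 * (t - q)) * (2 * (t - q) / q) = P1 t q / q"
      using eventually_gt_at_bot[of t]
      by eventually_elim (auto simp: P1_eq_pressure)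
  qed
  have "((\<lambda>q. 2 * (- deriv pressure (2 * (t - q)))) \<longlongrightarrow> 2 * (- (- ln golden))) at_bot"
    by (intro tendsto_intros filterlim_compose[OF deriv_pressure_tendsto lim])
  then have "((\<lambda>q. 2 * (- deriv pressure (2 * (t - q)))) \<longlongrightarrow> gamma0) at_bot" by (simp add: g mult.commute[of _ 2])
  then show "((\<lambda>q. deriv (P1 t) q) \<longlongrightarrow> gamma0) at_bot"
  proof (rule Lim_transform_eventually)
    show "\<forall>\<^sub>F q in at_bot. 2 * (- deriv pressure (2 * (t - q))) = deriv (P1 t) q"
      using eventually_gt_at_bot[of "t - 1/2"] by eventually_elim (simp add: deriv_P1)
  qed
qed

end
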